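(* Let $h_1,h_2\subset S$ be a double helix joining the endpoints of $d_2$ to the endpoints of $d_1$, with $rot(h_1)=rot(h_2)=\theta$ and $0\le\theta\le\pi$. If $\Sigma\subset C$ is a disk-type minimal surface spanning $d_1$, $d_2$, $h_1$ and $h_2$ (that is, $\partial\Sigma=d_1\cup d_2\cup h_1\cup h_2$), then $\Sigma=H_C^\theta$.
   Context: All surfaces are two-dimensional, orientable and immersed in $\mathbb{R}^3$. A minimal surface is one with zero mean curvature; a disk-type surface is a surface topologically equivalent to a (closed) disk. $C\subset\mathbb{R}^3$ is a right circular solid cylinder of radius $r>0$ and height $h>0$ (arbitrary); coordinates are chosen so that $C=\{(x,y,z) : x^2+y^2\le r^2,\ 0\le z\le h\}$. It is bounded by the top disk $D_1$ ($z=h$), the bottom disk $D_2$ ($z=0$), and the cylindrical side surface $S=\{x^2+y^2=r^2,\ 0\le z\le h\}$. $d_1\subset D_1$ and $d_2\subset D_2$ are fixed diameters of these disks; they are allowed to be parallel. A double helix is a pair of helices $h_1,h_2\subset S$ that are symmetric to each other with respect to the axis of $C$ (the rotation by $\pi$ about the axis interchanges them); for rotation angle $0$ they are vertical segments. Rotation angle: for a curve $\gamma\subset S$ connecting two points $p,q\in S$, $rot(\gamma)$ is the oriented angle of the circular arc $proj(\gamma)$ joining $proj(p)$ to $proj(q)$, where $proj$ is the vertical projection of $S$ onto $\partial D_2$; that is, it is the total signed change of the (continuously lifted) polar angle along $\gamma$, curves between $d_2$ and $d_1$ being traversed from $d_2$ to $d_1$. For example, the helix $(r\cos u,r\sin u,bu)$,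 $0\le u\le\theta_0$, with $b>0$, has rotation angle $\theta_0$. $H_C^\theta$ denotes the compact piece of helicoid in $C$, ruled by horizontal segments through the axis of $C$, spanning $d_1$ and $d_2$, whose two boundary helices on $S$ have rotation angle $\theta$. Explicitly, $H_C^\theta=\{(s\cos(\varphi_0+\theta z/h),\, s\sin(\varphi_0+\theta z/h),\, z) : |s|\le r,\ 0\le z\le h\}$, where $\varphi_0$ is a direction angle of $d_2$ and $\varphi_0+\theta$ is a direction angle of $d_1$. $H_C^0$ is a planar rectangle. *)

theory Defs
  imports "HOL-Analysis.Analysis"
begin

section \<open>Immersed minimal disks\<close>

definition dir_deriv ::
    "('a::real_normed_vector \<Rightarrow> 'b::real_normed_vector) \<Rightarrow> 'a \<Rightarrow> 'a \<Rightarrow> 'b" where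
  "dir_deriv f v p = frechet_derivative f (at p) v"

definition C1_on ::
    "'a::real_normed_vector set \<Rightarrow> ('a \<Rightarrow> 'b::real_normed_vector) \<Rightarrow> bool" where
  "C1_on U f \<longleftrightarrow>
     (\<forall>p\<in>U. f differentiable (at p)) \<and> (\<forall>v. continuous_on U (dir_deriv f v))"

definition C2_on ::
    "'a::real_normed_vector set \<Rightarrow> ('a \<Rightarrow> 'b::real_normed_vector) \<Rightarrow> bool" where
  "C2_on U f \<longleftrightarrow> C1_on U f \<and> (\<forall>v. C1_on U (dir_deriv f v))"

text \<open>Mean curvature of a parametrized surface in \<open>\<real>\<^sup>3\<close>, in terms of the coefficients of its
  first and second fundamental forms:
  \<open>(E N - 2 F M + G L) / (2 (E G - F\<^sup>2))\<close>.\<close>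

definition unit_normal :: "(real^2 \<Rightarrow> real^3) \<Rightarrow> real^2 \<Rightarrow> real^3" where
  "unit_normal f p =
     (let n = cross3 (dir_deriv f (axis 1 1) p) (dir_deriv f (axis 2 1) p) in n /\<^sub>R norm n)"

definition fundamental_form1 :: "(real^2 \<Rightarrow> real^3) \<Rightarrow> real^2 \<Rightarrow> 2 \<Rightarrow> 2 \<Rightarrow> real" where
  "fundamental_form1 f p i j = dir_deriv f (axis i 1) p \<bullet> dir_deriv f (axis j 1) p"

definition fundamental_form2 :: "(real^2 \<Rightarrow> real^3) \<Rightarrow> real^2 \<Rightarrow> 2 \<Rightarrow> 2 \<Rightarrow> real" where
  "fundamental_form2 f p i j =
     dir_deriv (dir_deriv f (axis j 1)) (axis i 1) p \<bullet> unit_normal f p"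

definition mean_curvature :: "(real^2 \<Rightarrow> real^3) \<Rightarrow> real^2 \<Rightarrow> real" where
  "mean_curvature f p =
     (let g = fundamental_form1 f p; b = fundamental_form2 f p in
        (g 1 1 * b 2 2 - 2 * g 1 2 * b 1 2 + g 2 2 * b 1 1)
          / (2 * (g 1 1 * g 2 2 - (g 1 2)\<^sup>2)))"

text \<open>\<open>disk_type_minimal_surface \<Sigma> \<Gamma>\<close>: the set \<open>\<Sigma>\<close> is the image of a closed disk under a continuous
  map that is a \<open>C\<^sup>2\<close> immersion with zero mean curvature on the open disk and takes the boundary
  circle bijectively (hence homeomorphically) to the Jordan curve \<open>\<Gamma> = \<partial>\<Sigma>\<close>. Nothing beyond
  continuity is asked at the boundary, as \<open>\<Gamma>\<close> may have corners. Self-intersections in the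
  interior are allowed; orientability is automatic for a disk.\<close>

definition disk_type_minimal_surface :: "(real^3) set \<Rightarrow> (real^3) set \<Rightarrow> bool" where
  "disk_type_minimal_surface \<Sigma> \<Gamma> \<longleftrightarrow>
     (\<exists>f :: real^2 \<Rightarrow> real^3.
        continuous_on (cball 0 1) f \<and>
        C2_on (ball 0 1) f \<and>
        (\<forall>p\<in>ball 0 1. inj (frechet_derivative f (at p))) \<and>
        (\<forall>p\<in>ball 0 1. mean_curvature f p = 0) \<and>
        f ` cball 0 1 = \<Sigma> \<and>
        bij_betw f (sphere 0 1) \<Gamma>)"

section \<open>The cylinder, diameters, helices and the helicoid\<close>

definition solid_cylinder :: "real \<Rightarrow> real \<Rightarrow> (real^3) set" where
  "solid_cylinder r h = {p. (p$1)\<^sup>2 + (p$2)\<^sup>2 \<le> r\<^sup>2 \<and> 0 \<le> p$3 \<and> p$3 \<le> h}"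

definition side_surface :: "real \<Rightarrow> real \<Rightarrow> (real^3) set" where
  "side_surface r h = {p. (p$1)\<^sup>2 + (p$2)\<^sup>2 = r\<^sup>2 \<and> 0 \<le> p$3 \<and> p$3 \<le> h}"

text \<open>The point with signed polar radius \<open>s\<close>, polar angle \<open>\<phi>\<close> and height \<open>z\<close>.\<close>

definition cyl :: "real \<Rightarrow> real \<Rightarrow> real \<Rightarrow> real^3" where
  "cyl s \<phi> z = vector [s * cos \<phi>, s * sin \<phi>, z]"

text \<open>The diameter with direction angle \<open>\<phi>\<close> of the horizontal disk of radius \<open>r\<close> at height \<open>z\<close>.\<close>

definition diameter_at :: "real \<Rightarrow> real \<Rightarrow> real \<Rightarrow> (real^3) set" where
  "diameter_at r z \<phi> = {cyl s \<phi> z |s. \<bar>s\<bar> \<le> r}"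

definition diameter_ends :: "real \<Rightarrow> real \<Rightarrow> real \<Rightarrow> (real^3) set" where
  "diameter_ends r z \<phi> = {cyl r \<phi> z, cyl (- r) \<phi> z}"

text \<open>A helix on the cylinder of radius \<open>r\<close>, parametrized proportionally to height on \<open>[0,1]\<close>;
  \<open>\<omega> = 0\<close> gives vertical segments.\<close>

definition helix :: "real \<Rightarrow> (real \<Rightarrow> real^3) \<Rightarrow> bool" where
  "helix r \<gamma> \<longleftrightarrow>
     (\<exists>\<alpha> \<omega> c k. k \<noteq> 0 \<and> (\<forall>t\<in>{0..1}. \<gamma> t = cyl r (\<alpha> + \<omega> * t) (c + k * t)))"

definition half_turn :: "real^3 \<Rightarrow> real^3" where
  "half_turn p = vector [- p$1, - p$2, p$3]"

definition double_helix :: "real \<Rightarrow> (real \<Rightarrow> real^3) \<Rightarrow> (real \<Rightarrow> real^3) \<Rightarrow> bool" where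
  "double_helix r \<gamma>1 \<gamma>2 \<longleftrightarrow>
     helix r \<gamma>1 \<and> helix r \<gamma>2 \<and> path_image \<gamma>2 = half_turn ` path_image \<gamma>1"

text \<open>Rotation angle of a path on the cylinder of radius \<open>r\<close>: the total change of a continuous lift
  of the polar angle. The definite description is justified by \<open>rot_eqI\<close> below.\<close>

definition polar_lift :: "real \<Rightarrow> (real \<Rightarrow> real^3) \<Rightarrow> (real \<Rightarrow> real) \<Rightarrow> bool" where
  "polar_lift r \<gamma> \<phi> \<longleftrightarrow>
     continuous_on {0..1} \<phi> \<and>
     (\<forall>t\<in>{0..1}. \<gamma> t $ 1 = r * cos (\<phi> t) \<and> \<gamma> t $ 2 = r * sin (\<phi> t))"

definition rot :: "real \<Rightarrow> (real \<Rightarrow> real^3) \<Rightarrow> real" where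
  "rot r \<gamma> = (THE a. \<exists>\<phi>. polar_lift r \<gamma> \<phi> \<and> a = \<phi> 1 - \<phi> 0)"

lemma polar_lift_unique:
  assumes "r > 0" "polar_lift r \<gamma> \<phi>" "polar_lift r \<gamma> \<psi>"
  shows "\<phi> 1 - \<phi> 0 = \<psi> 1 - \<psi> 0"
proof -
  let ?d = "\<lambda>t. \<phi> t - \<psi> t"
  have cont: "continuous_on {0..1} ?d"
    using assms(2,3) by (auto simp: polar_lift_def intro!: continuous_intros)
  have per: "\<exists>n::int. ?d t = 2 * pi * n" if "t \<in> {0..1}" for t
  proof -
    have "sin (\<phi> t) = sin (\<psi> t) \<and> cos (\<phi> t) = cos (\<psi> t)"
      using that assms unfolding polar_lift_def by (metis less_irrefl mult_left_cancel)
    then obtain n :: int where "\<phi> t = \<psi> t + 2 * pi * n"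
      using sin_cos_eq_iff[of "\<phi> t" "\<psi> t"] by auto
    then show ?thesis by auto
  qed
  have "?d constant_on {0..1}"
  proof (rule continuous_discrete_range_constant[OF _ cont])
    show "connected {0..1::real}" by simp
    fix x :: real assume x: "x \<in> {0..1}"
    have "2 * pi \<le> norm (?d y - ?d x)" if y: "y \<in> {0..1}" and ne: "?d y \<noteq> ?d x" for y
    proof -
      obtain m n :: int where mn: "?d x = 2 * pi * m" "?d y = 2 * pi * n"
        using per x y by blast
      then have "n \<noteq> m" using ne by auto
      then have "1 \<le> \<bar>real_of_int (n - m)\<bar>" by linarith
      moreover have "norm (?d y - ?d x) = 2 * pi * \<bar>real_of_int (n - m)\<bar>"
        unfolding mn by (simp add: abs_mult flip: right_diff_distrib)
      ultimately show ?thesis by simp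
    qed
    then show "\<exists>e>0. \<forall>y. y \<in> {0..1} \<and> ?d y \<noteq> ?d x \<longrightarrow> e \<le> norm (?d y - ?d x)"
      by (intro exI[of _ "2 * pi"]) auto
  qed
  then have "?d 1 = ?d 0"
    unfolding constant_on_def by (metis atLeastAtMost_iff order_refl zero_le_one)
  then show ?thesis by linarith
qed

lemma rot_eqI:
  assumes "r > 0" "polar_lift r \<gamma> \<phi>"
  shows "rot r \<gamma> = \<phi> 1 - \<phi> 0"
  unfolding rot_def using polar_lift_unique[OF assms(1)] assms(2) by (intro the_equality) blast+

lemma rot_helix:
  assumes "r > 0" "\<And>t. t \<in> {0..1} \<Longrightarrow> \<gamma> t = cyl r (\<alpha> + \<omega> * t) (c + k * t)"
  shows "rot r \<gamma> = \<omega>"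
proof -
  have "polar_lift r \<gamma> (\<lambda>t. \<alpha> + \<omega> * t)"
    unfolding polar_lift_def using assms(2) by (auto simp: cyl_def intro!: continuous_intros)
  from rot_eqI[OF assms(1) this] show ?thesis by simp
qed

text \<open>The piece of helicoid in the solid cylinder with rotation angle \<open>\<theta>\<close> whose bottom ruling has
  direction angle \<open>\<phi>\<^sub>0\<close>.\<close>

definition helicoid_piece :: "real \<Rightarrow> real \<Rightarrow> real \<Rightarrow> real \<Rightarrow> (real^3) set" where
  "helicoid_piece r h \<phi>\<^sub>0 \<theta> = {cyl s (\<phi>\<^sub>0 + \<theta> * z / h) z |s z. \<bar>s\<bar> \<le> r \<and> 0 \<le> z \<and> z \<le> h}"

end

theory Submission
  imports Defs
begin

text \<open>Put \<open>a = \<theta> / h\<close>, measure \<open>z\<close> from the middle height of the cylinder, and let \<open>x\<close> and \<open>y\<close> be the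
  horizontal coordinates along and across the middle ruling. The helicoid then has the equation
  \<open>y cos (a z) = x sin (a z)\<close>. Since \<open>\<theta> \<le> \<pi>\<close>, the angle \<open>a z\<close> stays in \<open>[-\<pi>/2, \<pi>/2]\<close>; so, except for the two
  end rulings when \<open>\<theta> = \<pi>\<close>, the helicoid is the graph \<open>y = x tan (a z)\<close>, and its translates in the
  \<open>y\<close>-direction foliate the slab \<open>|a z| < \<pi>/2\<close> by minimal surfaces. A minimal disk that has the same boundary but rises above
  the helicoid would touch the highest translate that it meets from below, which the maximum principle
  forbids.

  To use only the weak maximum principle, the foliation is replaced by the level sets of
    \<open>\<Psi> = y - x tan (a z) + k (x / cos (a z))\<^sup>2 + \<epsilon> ln (cos (a z))\<close>
  with \<open>k\<close> and \<open>\<epsilon>\<close> positive and \<open>\<epsilon>\<close> much smaller than \<open>k\<close>. At an interior maximum of \<open>\<Psi>\<close> on the disk,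
  the tangent plane of the disk is that of a level set, and vanishing mean curvature makes the trace of the Hessian of \<open>\<Psi>\<close> over this plane nonpositive
  (\<open>minimal_surface_at_max\<close>). An exact computation (\<open>barrier_curvature_identity\<close>) shows that this trace is
  positive, so there is no such maximum (\<open>barrier_no_interior_max\<close>). The term with \<open>k\<close> provides the strict
  inequality. The term with \<open>\<epsilon>\<close> tends to \<open>-\<infinity>\<close> at the end rulings, where \<open>tan\<close> is singular, and thus
  forces the maximum to be attained, as long as the rest of \<open>\<Psi>\<close> is bounded there. For \<open>\<theta> = \<pi>\<close> this holds
  because the disk lies in the convex hull of its boundary (\<open>linear_bound_from_boundary\<close>), which is a thin
  wedge near each end ruling. On the boundary \<open>\<Psi> \<le> k r\<^sup>2\<close>, and letting \<open>\<epsilon>\<close> and \<open>k\<close> tend to \<open>0\<close>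
  gives \<open>y \<le> x tan (a z)\<close> on the whole disk; the opposite inequality holds by symmetry
  (\<open>one_sided_bound\<close>).

  So the disk lies in the helicoid. It covers the helicoid, because a disk that is mapped into a
  topological disk and carries its own boundary circle homeomorphically onto the boundary cannot omit a point:
  otherwise the circle would be a retract of the disk (\<open>disk_map_onto_convex_patch\<close>).\<close>

section \<open>Mixed derivatives and maxima\<close>

text \<open>The mean value theorem in direction \<open>u\<close> and then in direction \<open>v\<close>. The left-hand side is symmetric in
  \<open>u\<close> and \<open>v\<close>, which is why mixed derivatives commute.\<close>

lemma second_difference_mean_value:
  fixes \<phi> :: "'a::real_normed_vector \<Rightarrow> real"
  assumes "t > 0"
    and W: "\<And>a b. \<lbrakk>0 \<le> a; a \<le> t; 0 \<le> b; b \<le> t\<rbrakk> \<Longrightarrow> p + a *\<^sub>R u + b *\<^sub>R v \<in> W"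
    and Du: "\<And>q. q \<in> W \<Longrightarrow> ((\<lambda>s. \<phi> (q + s *\<^sub>R u)) has_real_derivative Du q) (at 0)"
    and Dvu: "\<And>q. q \<in> W \<Longrightarrow> ((\<lambda>s. Du (q + s *\<^sub>R v)) has_real_derivative Dvu q) (at 0)"
  shows "\<exists>a b. 0 < a \<and> a < t \<and> 0 < b \<and> b < t \<and>
     \<phi> (p + t *\<^sub>R u + t *\<^sub>R v) - \<phi> (p + t *\<^sub>R u) - \<phi> (p + t *\<^sub>R v) + \<phi> p
       = t * t * Dvu (p + a *\<^sub>R u + b *\<^sub>R v)"
proof -
  have shift: "((\<lambda>s. F (q + s *\<^sub>R w)) has_real_derivative d) (at x)"
    if "((\<lambda>s. F ((q + x *\<^sub>R w) + s *\<^sub>R w)) has_real_derivative d) (at 0)"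
    for F :: "'a \<Rightarrow> real" and q w d x
  proof -
    have "(\<lambda>s. F ((q + x *\<^sub>R w) + s *\<^sub>R w)) = (\<lambda>s. F (q + (s + x) *\<^sub>R w))"
      by (auto simp: scaleR_add_left add.assoc add.commute[of "x *\<^sub>R w"])
    then have "((\<lambda>s. F (q + s *\<^sub>R w)) has_real_derivative d) (at (0 + x))"
      using that by (subst DERIV_shift) (simp only:)
    then show ?thesis by simp
  qed
  define g where "g = (\<lambda>a. \<phi> (p + t *\<^sub>R v + a *\<^sub>R u) - \<phi> (p + a *\<^sub>R u))"
  have "(g has_real_derivative Du (p + t *\<^sub>R v + a *\<^sub>R u) - Du (p + a *\<^sub>R u)) (at a)"
    if "0 \<le> a" "a \<le> t" for a
    unfolding g_def
    using W[OF that, of 0] W[OF that, of t] \<open>t > 0\<close>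
    by (intro DERIV_diff; intro shift[OF Du]) (auto simp: algebra_simps)
  then obtain a where a: "0 < a" "a < t"
      "g t - g 0 = (t - 0) * (Du (p + t *\<^sub>R v + a *\<^sub>R u) - Du (p + a *\<^sub>R u))"
    using MVT2[OF \<open>t > 0\<close>, of g "\<lambda>a. Du (p + t *\<^sub>R v + a *\<^sub>R u) - Du (p + a *\<^sub>R u)"] by auto
  have "((\<lambda>b. Du (p + a *\<^sub>R u + b *\<^sub>R v)) has_real_derivative Dvu (p + a *\<^sub>R u + b *\<^sub>R v)) (at b)"
    if "0 \<le> b" "b \<le> t" for b
    using W[of a b] that a by (intro shift[OF Dvu]) auto
  then obtain b where b: "0 < b" "b < t"
      "Du (p + a *\<^sub>R u + t *\<^sub>R v) - Du (p + a *\<^sub>R u + 0 *\<^sub>R v) = (t - 0) * Dvu (p + a *\<^sub>R u + b *\<^sub>R v)"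
    using MVT2[OF \<open>t > 0\<close>, of "\<lambda>b. Du (p + a *\<^sub>R u + b *\<^sub>R v)" "\<lambda>b. Dvu (p + a *\<^sub>R u + b *\<^sub>R v)"] by auto
  show ?thesis
    using a b by (intro exI[of _ a] exI[of _ b]) (simp add: g_def algebra_simps)
qed

lemma mixed_derivatives_commute:
  fixes \<phi> :: "'a::real_normed_vector \<Rightarrow> real"
  assumes "open W" "p \<in> W"
    and Du: "\<And>q. q \<in> W \<Longrightarrow> ((\<lambda>s. \<phi> (q + s *\<^sub>R u)) has_real_derivative Du q) (at 0)"
    and Dv: "\<And>q. q \<in> W \<Longrightarrow> ((\<lambda>s. \<phi> (q + s *\<^sub>R v)) has_real_derivative Dv q) (at 0)"
    and Dvu: "\<And>q. q \<in> W \<Longrightarrow> ((\<lambda>s. Du (q + s *\<^sub>R v)) has_real_derivative Dvu q) (at 0)"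
    and Duv: "\<And>q. q \<in> W \<Longrightarrow> ((\<lambda>s. Dv (q + s *\<^sub>R u)) has_real_derivative Duv q) (at 0)"
    and cont: "continuous_on W Dvu" "continuous_on W Duv"
  shows "Duv p = Dvu p"
proof (rule ccontr)
  assume ne: "Duv p \<noteq> Dvu p"
  define e where "e = \<bar>Duv p - Dvu p\<bar> / 2"
  have "e > 0" using ne by (simp add: e_def)
  have "isCont Dvu p" "isCont Duv p"
    using cont assms(1,2) continuous_on_eq_continuous_at by blast+
  then have "\<exists>d>0. \<forall>q. dist q p < d \<longrightarrow> dist (Dvu q) (Dvu p) < e"
      "\<exists>d>0. \<forall>q. dist q p < d \<longrightarrow> dist (Duv q) (Duv p) < e"
    using \<open>e > 0\<close> unfolding continuous_at_eps_delta by auto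
  then obtain d1 d2 where d1: "d1 > 0" "\<And>q. dist q p < d1 \<Longrightarrow> dist (Dvu q) (Dvu p) < e"
      and d2: "d2 > 0" "\<And>q. dist q p < d2 \<Longrightarrow> dist (Duv q) (Duv p) < e"
    by blast
  obtain d3 where d3: "d3 > 0" "ball p d3 \<subseteq> W"
    using assms(1,2) open_contains_ball by blast
  define d where "d = min d1 (min d2 d3)"
  have "d > 0" using d1 d2 d3 by (simp add: d_def)
  \<comment> \<open>so small that the parallelogram at \<open>p\<close> with sides \<open>t u\<close> and \<open>t v\<close> lies in the ball of radius \<open>d\<close>\<close>
  define t where "t = d / (norm u + norm v + 1)"
  have n: "norm u + norm v + 1 > 0" by (smt (verit) norm_ge_zero)
  then have "t > 0" using \<open>d > 0\<close> by (simp add: t_def)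
  have near: "dist (p + a *\<^sub>R u + b *\<^sub>R v) p < d" if "0 \<le> a" "a \<le> t" "0 \<le> b" "b \<le> t" for a b
  proof -
    have "dist (p + a *\<^sub>R u + b *\<^sub>R v) p = norm (a *\<^sub>R u + b *\<^sub>R v)"
      by (simp add: dist_norm algebra_simps)
    also have "\<dots> \<le> a * norm u + b * norm v"
      using that by (metis abs_of_nonneg norm_scaleR norm_triangle_ineq)
    also have "\<dots> \<le> t * norm u + t * norm v"
      using that by (intro add_mono mult_right_mono) auto
    also have "\<dots> < t * (norm u + norm v + 1)"
      using \<open>t > 0\<close> by (simp add: algebra_simps)
    also have "\<dots> = d" using n by (simp add: t_def)
    finally show ?thesis .
  qed
  have inW: "p + a *\<^sub>R u + b *\<^sub>R v \<in> W" if "0 \<le> a" "a \<le> t" "0 \<le> b" "b \<le> t" for a b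
    using near[OF that] d3(2) by (auto simp: d_def dist_commute)
  obtain a b where ab: "0 < a" "a < t" "0 < b" "b < t" and
     1: "\<phi> (p + t *\<^sub>R u + t *\<^sub>R v) - \<phi> (p + t *\<^sub>R u) - \<phi> (p + t *\<^sub>R v) + \<phi> p
       = t * t * Dvu (p + a *\<^sub>R u + b *\<^sub>R v)"
    using second_difference_mean_value[OF \<open>t > 0\<close> inW Du Dvu] by blast
  have inW': "p + a *\<^sub>R v + b *\<^sub>R u \<in> W" if "0 \<le> a" "a \<le> t" "0 \<le> b" "b \<le> t" for a b
    using inW[OF that(3,4,1,2)] by (simp add: algebra_simps)
  obtain a' b' where ab': "0 < a'" "a' < t" "0 < b'" "b' < t" and
     2: "\<phi> (p + t *\<^sub>R v + t *\<^sub>R u) - \<phi> (p + t *\<^sub>R v) - \<phi> (p + t *\<^sub>R u) + \<phi> p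
       = t * t * Duv (p + a' *\<^sub>R v + b' *\<^sub>R u)"
    using second_difference_mean_value[OF \<open>t > 0\<close> inW' Dv Duv] by blast
  have "t * t * Dvu (p + a *\<^sub>R u + b *\<^sub>R v) = t * t * Duv (p + a' *\<^sub>R v + b' *\<^sub>R u)"
    using 1 2 by (simp add: algebra_simps)
  then have "Dvu (p + a *\<^sub>R u + b *\<^sub>R v) = Duv (p + b' *\<^sub>R u + a' *\<^sub>R v)"
    using \<open>t > 0\<close> by (simp add: algebra_simps)
  moreover have "dist (Dvu (p + a *\<^sub>R u + b *\<^sub>R v)) (Dvu p) < e"
    using near[of a b] ab by (intro d1(2)) (auto simp: d_def)
  moreover have "dist (Duv (p + b' *\<^sub>R u + a' *\<^sub>R v)) (Duv p) < e"
    using near[of b' a'] ab' by (intro d2(2)) (auto simp: d_def)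
  ultimately show False unfolding e_def dist_real_def by (smt (verit) field_sum_of_halves)
qed

text \<open>The derivative \<open>\<phi>'\<close> is assumed to exist near \<open>0\<close> but to be differentiable only at \<open>0\<close>; this is all that the
  composition of a surface with a twice differentiable function along a line provides.\<close>

lemma second_derivative_nonpos_at_local_max:
  fixes \<phi> :: "real \<Rightarrow> real"
  assumes "\<delta> > 0"
    and d1: "\<And>x. \<bar>x\<bar> < \<delta> \<Longrightarrow> (\<phi> has_real_derivative \<phi>' x) (at x)"
    and d2: "(\<phi>' has_real_derivative c) (at 0)"
    and max: "\<And>x. \<bar>x\<bar> < \<delta> \<Longrightarrow> \<phi> x \<le> \<phi> 0"
  shows "\<phi>' 0 = 0" "c \<le> 0"
proof -
  show z: "\<phi>' 0 = 0"
    using DERIV_local_max[OF d1[of 0] \<open>\<delta> > 0\<close>] max \<open>\<delta> > 0\<close> by simp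
  show "c \<le> 0"
  proof (rule ccontr)
    assume "\<not> c \<le> 0"
    then obtain d where d: "d > 0" "\<And>x. 0 < x \<Longrightarrow> x < d \<Longrightarrow> \<phi>' 0 < \<phi>' (0 + x)"
      using DERIV_pos_inc_right[OF d2] by auto
    define x where "x = min d \<delta> / 2"
    have x: "0 < x" "x < d" "x < \<delta>" using d(1) \<open>\<delta> > 0\<close> by (auto simp: x_def)
    obtain y where "0 < y" "y < x" "\<phi> x - \<phi> 0 = (x - 0) * \<phi>' y"
      using MVT2[of 0 x \<phi> \<phi>'] x d1 by force
    moreover from this have "x * \<phi>' y > 0"
      using d(2)[of y] x z by simp
    ultimately have "\<phi> x > \<phi> 0" by simp
    then show False using max[of x] x by auto
  qed
qed

section \<open>The maximum principle on a minimal surface\<close>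

lemma dir_deriv_has_derivative:
  assumes "C1_on U f" "p \<in> U"
  shows "(f has_derivative (\<lambda>v. dir_deriv f v p)) (at p)"
  using assms unfolding C1_on_def dir_deriv_def by (auto simp: frechet_derivative_works)

lemma has_vector_derivative_along_line:
  assumes "C1_on U f" "p + s *\<^sub>R v \<in> U"
  shows "((\<lambda>s. f (p + s *\<^sub>R v)) has_vector_derivative dir_deriv f v (p + s *\<^sub>R v)) (at s)"
proof -
  have lin: "linear (\<lambda>w. dir_deriv f w (p + s *\<^sub>R v))"
    using dir_deriv_has_derivative[OF assms] has_derivative_linear by blast
  have "((\<lambda>s. p + s *\<^sub>R v) has_derivative (\<lambda>h. h *\<^sub>R v)) (at s)"
    by (auto intro!: derivative_eq_intros)
  then have "((\<lambda>s. f (p + s *\<^sub>R v)) has_derivative (\<lambda>h. dir_deriv f (h *\<^sub>R v) (p + s *\<^sub>R v))) (at s)"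
    using has_derivative_compose[of "\<lambda>s. p + s *\<^sub>R v" _ s UNIV f] dir_deriv_has_derivative[OF assms]
    by blast
  then show ?thesis
    by (simp add: has_vector_derivative_def linear_cmul[OF lin])
qed

lemma dir_deriv_axis_sum:
  fixes f :: "real^2 \<Rightarrow> 'b::real_normed_vector"
  assumes "C1_on U f" "p \<in> U"
  shows "dir_deriv f v p = v$1 *\<^sub>R dir_deriv f (axis 1 1) p + v$2 *\<^sub>R dir_deriv f (axis 2 1) p"
proof -
  have lin: "linear (\<lambda>w. dir_deriv f w p)"
    using dir_deriv_has_derivative[OF assms] has_derivative_linear by blast
  have "v = v$1 *\<^sub>R axis 1 1 + v$2 *\<^sub>R axis 2 1"
    by (simp add: vec_eq_iff forall_2 axis_def)
  then show ?thesis
    by (metis (no_types) lin linear_add linear_cmul)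
qed

lemma second_dir_derivs_commute:
  fixes f :: "'a::real_normed_vector \<Rightarrow> 'b::real_inner"
  assumes "C2_on U f" "open U" "p \<in> U"
  shows "dir_deriv (dir_deriv f u) v p = dir_deriv (dir_deriv f v) u p"
proof -
  have C: "C1_on U f" "\<And>w. C1_on U (dir_deriv f w)"
    using assms(1) by (auto simp: C2_on_def)
  have d: "((\<lambda>s. b \<bullet> g (q + s *\<^sub>R w)) has_real_derivative b \<bullet> dir_deriv g w q) (at 0)"
    if "C1_on U g" "q \<in> U" for g :: "'a \<Rightarrow> 'b" and b q w
    using bounded_linear.has_vector_derivative[OF bounded_linear_inner_right
        has_vector_derivative_along_line[of U g q 0 w], of b] that
    by (simp add: has_real_derivative_iff_has_vector_derivative)
  have c: "continuous_on U (\<lambda>q. b \<bullet> dir_deriv (dir_deriv f w) w' q)" for b w w'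
    using C(2) unfolding C1_on_def by (auto intro!: continuous_intros)
  have "b \<bullet> dir_deriv (dir_deriv f v) u p = b \<bullet> dir_deriv (dir_deriv f u) v p" for b
    by (rule mixed_derivatives_commute[OF assms(2,3) d[OF C(1)] d[OF C(1)] d[OF C(2)] d[OF C(2)] c c])
  then show ?thesis
    by (metis vector_eq_ldot)
qed

text \<open>The one-dimensional test applied to \<open>\<Psi> \<circ> f\<close> on the line through \<open>p\<close> in direction \<open>v\<close>. Its second derivative
  there has one term from the Hessian \<open>H\<close> of \<open>\<Psi>\<close> and one from the second derivative of the
  surface in the direction of the gradient \<open>G\<close>.\<close>

lemma hessian_nonpos_at_max_on_surface:
  fixes f :: "'a::real_normed_vector \<Rightarrow> 'b::real_inner"
  assumes f: "C2_on U f" "open U" "p \<in> U"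
    and W: "open W" "f p \<in> W"
    and G: "\<And>q. q \<in> W \<Longrightarrow> (\<Psi> has_derivative (\<lambda>v. G q \<bullet> v)) (at q)"
    and H: "(G has_derivative H) (at (f p))"
    and max: "\<forall>\<^sub>F q in nhds p. \<Psi> (f q) \<le> \<Psi> (f p)"
  shows "G (f p) \<bullet> dir_deriv f v p = 0"
    and "H (dir_deriv f v p) \<bullet> dir_deriv f v p + G (f p) \<bullet> dir_deriv (dir_deriv f v) v p \<le> 0"
proof -
  have C: "C1_on U f" "\<And>w. C1_on U (dir_deriv f w)"
    using f(1) by (auto simp: C2_on_def)
  have "isCont f p"
    using C(1) f(3) by (simp add: C1_on_def differentiable_imp_continuous_within)
  then have "\<forall>\<^sub>F q in nhds p. f q \<in> W"
    using W by (metis (no_types) continuous_within tendsto_at_iff_tendsto_nhds topological_tendstoD)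
  moreover have "\<forall>\<^sub>F q in nhds p. q \<in> U"
    using f(2,3) by (rule eventually_nhds_in_open)
  ultimately have "\<forall>\<^sub>F q in nhds p. q \<in> U \<and> f q \<in> W \<and> \<Psi> (f q) \<le> \<Psi> (f p)"
    using max by eventually_elim auto
  moreover have "filterlim (\<lambda>s. p + s *\<^sub>R v) (nhds p) (nhds (0::real))"
    using tendsto_at_iff_tendsto_nhds[of "\<lambda>s. p + s *\<^sub>R v" "0::real"] by (auto intro!: tendsto_eq_intros)
  ultimately have "\<forall>\<^sub>F s in nhds (0::real). p + s *\<^sub>R v \<in> U \<and> f (p + s *\<^sub>R v) \<in> W \<and> \<Psi> (f (p + s *\<^sub>R v)) \<le> \<Psi> (f p)"
    unfolding filterlim_iff by auto
  then obtain \<delta> where \<delta>: "\<delta> > 0" "\<And>s. \<bar>s\<bar> < \<delta> \<Longrightarrow> p + s *\<^sub>R v \<in> U \<and> f (p + s *\<^sub>R v) \<in> W \<and> \<Psi> (f (p + s *\<^sub>R v)) \<le> \<Psi> (f p)"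
    unfolding eventually_nhds_metric by (auto simp: dist_real_def)
  let ?c = "\<lambda>s. f (p + s *\<^sub>R v)" and ?c' = "\<lambda>s. dir_deriv f v (p + s *\<^sub>R v)"
  have c: "(?c has_vector_derivative ?c' s) (at s)" if "\<bar>s\<bar> < \<delta>" for s
    using has_vector_derivative_along_line[OF C(1)] \<delta>(2) that by blast
  have 1: "((\<lambda>s. \<Psi> (?c s)) has_real_derivative G (?c s) \<bullet> ?c' s) (at s)" if "\<bar>s\<bar> < \<delta>" for s
    using has_derivative_compose[OF c[OF that, unfolded has_vector_derivative_def] G] \<delta>(2) that
    by (simp add: has_field_derivative_def mult_commute_abs)
  have c2: "(?c' has_derivative (\<lambda>h. h *\<^sub>R dir_deriv (dir_deriv f v) v p)) (at 0)"
    using has_vector_derivative_along_line[OF C(2), of p 0 v v] f(3)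
    by (simp add: has_vector_derivative_def)
  have lin: "linear H"
    using H has_derivative_linear by blast
  have "((\<lambda>s. G (?c s)) has_derivative (\<lambda>h. H (h *\<^sub>R ?c' 0))) (at 0)"
    using has_derivative_compose[OF c[of 0, unfolded has_vector_derivative_def]] H \<delta>(1) by simp
  then have 2: "((\<lambda>s. G (?c s) \<bullet> ?c' s) has_real_derivative
     H (dir_deriv f v p) \<bullet> dir_deriv f v p + G (f p) \<bullet> dir_deriv (dir_deriv f v) v p) (at 0)"
    unfolding has_field_derivative_def
    by (rule has_derivative_eq_rhs[OF has_derivative_inner[OF _ c2]])
      (auto simp: fun_eq_iff linear_cmul[OF lin] algebra_simps)
  show "G (f p) \<bullet> dir_deriv f v p = 0"
    "H (dir_deriv f v p) \<bullet> dir_deriv f v p + G (f p) \<bullet> dir_deriv (dir_deriv f v) v p \<le> 0"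
    using second_derivative_nonpos_at_local_max[OF \<delta>(1) 1 2] \<delta>(2) by simp_all
qed

lemma multiple_of_cross_if_orthogonal:
  fixes x y g :: "real^3"
  assumes "cross3 x y \<noteq> 0" "g \<bullet> x = 0" "g \<bullet> y = 0"
  shows "\<exists>c. g = c *\<^sub>R cross3 x y"
proof -
  have "cross3 (cross3 x y) g = 0"
    using assms(2,3) by (simp add: Lagrange cross_skew[of _ g] inner_commute)
  then have "collinear {0, cross3 x y, g}"
    by (simp add: cross_eq_0)
  then show ?thesis
    using assms(1) by (auto simp: collinear_lemma)
qed

text \<open>For \<open>x\<close> and \<open>y\<close> spanning a plane with Gram matrix \<open>g\<close>, the left-hand side is \<open>det g\<close> times the trace of
  the quadratic form of \<open>H\<close> over this plane; the right-hand side is \<open>|N|\<^sup>2\<close> times the full trace minus the value in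
  the normal direction \<open>N = x \<times> y\<close>. The right-hand side depends on the plane only through its normal, so that
  the surface disappears from the second-order condition below.\<close>

lemma trace_orthogonal_to_cross:
  fixes x y :: "real^3" and H :: "real^3 \<Rightarrow> real^3"
  assumes "linear H"
  shows "(y \<bullet> y) * (H x \<bullet> x) - (x \<bullet> y) * (H x \<bullet> y + H y \<bullet> x) + (x \<bullet> x) * (H y \<bullet> y)
    = (cross3 x y \<bullet> cross3 x y) * (\<Sum>b\<in>Basis. H b \<bullet> b) - H (cross3 x y) \<bullet> cross3 x y"
proof -
  define M where "M = matrix H"
  have H: "H = (\<lambda>v. M *v v)"
    unfolding M_def using assms by (simp add: matrix_works)
  have B: "(\<Sum>b\<in>Basis. H b \<bullet> b) = M$1$1 + M$2$2 + M$3$3"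
  proof -
    have b: "(Basis :: (real^3) set) = range (\<lambda>i. axis i 1)"
      by (auto simp: Basis_vec_def)
    have inj: "inj (\<lambda>i::3. axis i (1::real))"
      by (simp add: inj_def axis_eq_axis)
    have "(\<Sum>b\<in>Basis. H b \<bullet> b) = (\<Sum>i\<in>UNIV. H (axis i 1) \<bullet> axis i 1)"
      unfolding b by (subst sum.reindex[OF inj]) simp
    then show ?thesis
      by (simp add: H sum_3 inner_axis matrix_vector_mul_component)
  qed
  show ?thesis
    unfolding B unfolding H
    by (simp add: inner_vec_def sum_3 matrix_vector_mult_def cross3_def) algebra
qed

text \<open>The tangential trace of the Hessian of \<open>\<Psi> \<circ> f\<close> with respect to the induced metric is nonpositive at a
  maximum. It is the trace of \<open>H\<close> over the tangent plane plus the product of the gradient with the mean curvature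
  vector, and the latter vanishes. Since the gradient of \<open>\<Psi>\<close> is normal to the surface, the conclusion
  is a condition on the level set of \<open>\<Psi>\<close> through \<open>f p\<close>: it is not strictly mean convex there.\<close>

lemma minimal_surface_at_max:
  fixes f :: "real^2 \<Rightarrow> real^3"
  assumes f: "C2_on U f" "open U" "p \<in> U"
    and inj: "inj (frechet_derivative f (at p))"
    and minimal: "mean_curvature f p = 0"
    and W: "open W" "f p \<in> W"
    and G: "\<And>q. q \<in> W \<Longrightarrow> (\<Psi> has_derivative (\<lambda>v. G q \<bullet> v)) (at q)"
    and H: "(G has_derivative H) (at (f p))"
    and max: "\<forall>\<^sub>F q in nhds p. \<Psi> (f q) \<le> \<Psi> (f p)"
  obtains N c where "N \<noteq> 0" "G (f p) = c *\<^sub>R N"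
    "(N \<bullet> N) * (\<Sum>b\<in>Basis. H b \<bullet> b) \<le> H N \<bullet> N"
proof -
  define f1 f2 where "f1 = dir_deriv f (axis 1 1) p" and "f2 = dir_deriv f (axis 2 1) p"
  define N where "N = cross3 f1 f2"
  define f11 f12 f22 where "f11 = dir_deriv (dir_deriv f (axis 1 1)) (axis 1 1) p"
    and "f12 = dir_deriv (dir_deriv f (axis 2 1)) (axis 1 1) p"
    and "f22 = dir_deriv (dir_deriv f (axis 2 1)) (axis 2 1) p"
  have C: "C1_on U f" "\<And>w. C1_on U (dir_deriv f w)"
    using f(1) by (auto simp: C2_on_def)
  have N0: "N \<noteq> 0"
  proof
    assume "N = 0"
    then have "collinear {0, f1, f2}" by (simp add: N_def cross_eq_0)
    then consider "f1 = 0" | k where "f2 = k *\<^sub>R f1"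
      by (metis collinear_lemma scaleR_zero_left)
    then obtain v :: "real^2" where "v \<noteq> 0" "v$1 *\<^sub>R f1 + v$2 *\<^sub>R f2 = 0"
    proof cases
      case 1
      then show ?thesis by (intro that[of "axis 1 1"]) (auto simp: axis_def vec_eq_iff)
    next
      case 2
      then show ?thesis
        by (intro that[of "vector [-k, 1]"]) (auto simp: vec_eq_iff exI[of _ 2])
    qed
    then have "dir_deriv f v p = dir_deriv f 0 p"
      using dir_deriv_axis_sum[OF C(1) f(3), of v] dir_deriv_axis_sum[OF C(1) f(3), of 0]
      by (simp add: f1_def[symmetric] f2_def[symmetric])
    then show False
      using inj \<open>v \<noteq> 0\<close> by (auto simp: dir_deriv_def inj_def)
  qed
  have N2: "N \<bullet> N = (f1 \<bullet> f1) * (f2 \<bullet> f2) - (f1 \<bullet> f2)\<^sup>2"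
    unfolding N_def using norm_cross[of f1 f2] by (simp add: power2_norm_eq_inner)
  have Nm: "N \<bullet> ((f2 \<bullet> f2) *\<^sub>R f11 - (2 * (f1 \<bullet> f2)) *\<^sub>R f12 + (f1 \<bullet> f1) *\<^sub>R f22) = 0"
  proof -
    have "mean_curvature f p = (N \<bullet> ((f2 \<bullet> f2) *\<^sub>R f11 - (2 * (f1 \<bullet> f2)) *\<^sub>R f12 + (f1 \<bullet> f1) *\<^sub>R f22))
        / norm N / (2 * (N \<bullet> N))"
      unfolding mean_curvature_def Let_def fundamental_form1_def fundamental_form2_def
        unit_normal_def f1_def[symmetric] f2_def[symmetric] N_def[symmetric] f11_def[symmetric]
        f12_def[symmetric] f22_def[symmetric] N2
      by (simp add: inner_commute[of N] inner_add_left inner_diff_left divide_inverse algebra_simps)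
    then show ?thesis
      using minimal N0 by simp
  qed
  note crit = hessian_nonpos_at_max_on_surface[OF f W G H max]
  obtain c where c: "G (f p) = c *\<^sub>R N"
    using multiple_of_cross_if_orthogonal[of f1 f2 "G (f p)"] N0 crit(1)
    unfolding N_def f1_def f2_def by metis
  have lin: "linear H"
    using H has_derivative_linear by blast
  have hess: "H (a *\<^sub>R f1 + b *\<^sub>R f2) \<bullet> (a *\<^sub>R f1 + b *\<^sub>R f2)
      + c * (N \<bullet> (a\<^sup>2 *\<^sub>R f11 + (2 * a * b) *\<^sub>R f12 + b\<^sup>2 *\<^sub>R f22)) \<le> 0" for a b
  proof -
    define v :: "real^2" where "v = vector [a, b]"
    have w: "dir_deriv f v q = a *\<^sub>R dir_deriv f (axis 1 1) q + b *\<^sub>R dir_deriv f (axis 2 1) q" if "q \<in> U" for q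
      using dir_deriv_axis_sum[OF C(1) that, of v] by (simp add: v_def)
    have d: "dir_deriv (dir_deriv f v) u p = a *\<^sub>R dir_deriv (dir_deriv f (axis 1 1)) u p + b *\<^sub>R dir_deriv (dir_deriv f (axis 2 1)) u p" for u
    proof -
      have "((\<lambda>q. a *\<^sub>R dir_deriv f (axis 1 1) q + b *\<^sub>R dir_deriv f (axis 2 1) q) has_derivative
          (\<lambda>u. a *\<^sub>R dir_deriv (dir_deriv f (axis 1 1)) u p + b *\<^sub>R dir_deriv (dir_deriv f (axis 2 1)) u p)) (at p)"
        by (intro has_derivative_add has_derivative_scaleR_right dir_deriv_has_derivative[OF C(2) f(3)])
      then have "(dir_deriv f v has_derivative
          (\<lambda>u. a *\<^sub>R dir_deriv (dir_deriv f (axis 1 1)) u p + b *\<^sub>R dir_deriv (dir_deriv f (axis 2 1)) u p)) (at p)"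
        using w by (auto intro: has_derivative_transform_within_open[OF _ f(2,3)])
      from fun_cong[OF frechet_derivative_at[OF this], of u] show ?thesis
        by (simp add: dir_deriv_def[of "dir_deriv f v"])
    qed
    have "dir_deriv (dir_deriv f v) v p = a\<^sup>2 *\<^sub>R f11 + (2 * a * b) *\<^sub>R f12 + b\<^sup>2 *\<^sub>R f22"
      unfolding d[of v] dir_deriv_axis_sum[OF C(2) f(3), of "axis 1 1" v]
        dir_deriv_axis_sum[OF C(2) f(3), of "axis 2 1" v] f11_def f12_def f22_def
        second_dir_derivs_commute[OF f, of "axis 1 1" "axis 2 1"]
      by (simp add: v_def vec_eq_iff algebra_simps power2_eq_square)
    then show ?thesis
      using crit(2)[of v] w[OF f(3)] c by (simp add: f1_def f2_def)
  qed
  have "(N \<bullet> N) * (\<Sum>b\<in>Basis. H b \<bullet> b) - H N \<bullet> N \<le> 0"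
  proof -
    define E F K where "E = f1 \<bullet> f1" and "F = f1 \<bullet> f2" and "K = f2 \<bullet> f2"
    define T where "T = K * (H f1 \<bullet> f1) - F * (H f1 \<bullet> f2 + H f2 \<bullet> f1) + E * (H f2 \<bullet> f2)"
    have E: "E > 0"
      using N0 unfolding E_def N_def by (auto simp: cross_zero_left)
    have D: "E * K - F\<^sup>2 > 0"
      using N2 N0 by (metis E_def F_def K_def inner_gt_zero_iff)
    \<comment> \<open>\<open>E\<close> times the adjugate of the Gram matrix is the sum of \<open>E K - F\<^sup>2\<close> times the square of \<open>(1, 0)\<close>
      and the square of \<open>(- F, E)\<close>, so it suffices to test these two directions\<close>
    have "0 \<ge> (E * K - F\<^sup>2) * (H f1 \<bullet> f1 + c * (N \<bullet> f11))"
      using hess[of 1 0] D by (simp add: mult_nonneg_nonpos)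
    moreover have "0 \<ge> F\<^sup>2 * (H f1 \<bullet> f1) - E * F * (H f1 \<bullet> f2 + H f2 \<bullet> f1) + E\<^sup>2 * (H f2 \<bullet> f2)
       + c * (F\<^sup>2 * (N \<bullet> f11) - 2 * E * F * (N \<bullet> f12) + E\<^sup>2 * (N \<bullet> f22))"
      using hess[of "- F" E]
      by (simp add: linear_add[OF lin] linear_cmul[OF lin] linear_neg[OF lin] linear_diff[OF lin]
          inner_add_left inner_add_right inner_diff_left inner_diff_right algebra_simps power2_eq_square)
    ultimately have "0 \<ge> E * T + E * c * (K * (N \<bullet> f11) - 2 * F * (N \<bullet> f12) + E * (N \<bullet> f22))"
      unfolding T_def by (simp add: algebra_simps power2_eq_square)
    moreover have "K * (N \<bullet> f11) - 2 * F * (N \<bullet> f12) + E * (N \<bullet> f22) = 0"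
      using Nm by (simp add: E_def F_def K_def inner_add_right inner_diff_right)
    ultimately have "T \<le> 0"
      using E by (simp add: mult_le_0_iff)
    then show ?thesis
      using trace_orthogonal_to_cross[OF lin, of f2 f1] by (simp add: T_def E_def F_def K_def N_def)
  qed
  then show ?thesis
    using that[OF N0 c] by simp
qed

text \<open>A parametrized disk-type minimal surface whose boundary curve is left open.\<close>

locale minimal_disk =
  fixes f :: "real^2 \<Rightarrow> real^3"
  assumes continuous: "continuous_on (cball 0 1) f"
    and C2: "C2_on (ball 0 1) f"
    and immersion: "\<And>p. p \<in> ball 0 1 \<Longrightarrow> inj (frechet_derivative f (at p))"
    and minimal: "\<And>p. p \<in> ball 0 1 \<Longrightarrow> mean_curvature f p = 0"
begin

lemma no_interior_max:
  assumes "p \<in> ball 0 1" and W: "open W" "f p \<in> W"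
    and G: "\<And>q. q \<in> W \<Longrightarrow> (\<Psi> has_derivative (\<lambda>v. G q \<bullet> v)) (at q)"
    and H: "(G has_derivative H) (at (f p))"
    and strict: "\<And>N c. \<lbrakk>N \<noteq> 0; G (f p) = c *\<^sub>R N\<rbrakk> \<Longrightarrow> H N \<bullet> N < (N \<bullet> N) * (\<Sum>b\<in>Basis. H b \<bullet> b)"
  shows "\<not> (\<forall>\<^sub>F q in nhds p. \<Psi> (f q) \<le> \<Psi> (f p))"
proof
  assume "\<forall>\<^sub>F q in nhds p. \<Psi> (f q) \<le> \<Psi> (f p)"
  then obtain N c where "N \<noteq> 0" "G (f p) = c *\<^sub>R N" "(N \<bullet> N) * (\<Sum>b\<in>Basis. H b \<bullet> b) \<le> H N \<bullet> N"
    using minimal_surface_at_max[OF C2 open_ball assms(1) immersion[OF assms(1)] minimal[OF assms(1)] W G H]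
    by blast
  with strict show False by force
qed

text \<open>The convex hull property of minimal surfaces. Adding \<open>\<delta> |q|\<^sup>2\<close> makes the Hessian of the linear function
  positive, hence also its trace over every plane.\<close>

lemma linear_bound_from_boundary:
  assumes bd: "\<And>p. p \<in> sphere 0 1 \<Longrightarrow> b \<bullet> f p \<le> C" and "p \<in> cball 0 1"
  shows "b \<bullet> f p \<le> C"
proof (rule ccontr)
  assume "\<not> b \<bullet> f p \<le> C"
  then have gap: "b \<bullet> f p - C > 0" by simp
  have "bounded (f ` cball 0 1)"
    using continuous compact_continuous_image compact_imp_bounded compact_cball by blast
  then obtain M where M: "M > 0" "\<And>q. q \<in> cball 0 1 \<Longrightarrow> norm (f q) \<le> M"
    unfolding bounded_pos by auto
  define \<delta> where "\<delta> = (b \<bullet> f p - C) / (2 * M\<^sup>2)"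
  have \<delta>: "\<delta> > 0" "\<delta> * M\<^sup>2 < b \<bullet> f p - C"
    using gap M(1) by (auto simp: \<delta>_def)
  define \<Psi> where "\<Psi> = (\<lambda>q::real^3. b \<bullet> q + \<delta> * (q \<bullet> q))"
  have "continuous_on (cball 0 1) (\<lambda>q. \<Psi> (f q))"
    unfolding \<Psi>_def by (intro continuous_intros continuous)
  then obtain p1 where p1: "p1 \<in> cball 0 1" "\<And>q. q \<in> cball 0 1 \<Longrightarrow> \<Psi> (f q) \<le> \<Psi> (f p1)"
    using continuous_attains_sup[of "cball 0 1" "\<lambda>q. \<Psi> (f q)"] by auto
  have "p1 \<in> ball 0 1"
  proof (rule ccontr)
    assume "p1 \<notin> ball 0 1"
    then have "b \<bullet> f p1 \<le> C" using p1(1) bd by simp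
    moreover have "\<delta> * (f p1 \<bullet> f p1) \<le> \<delta> * M\<^sup>2"
      using M(2)[OF p1(1)] \<delta>(1) by (auto simp: power2_norm_eq_inner[symmetric] intro!: mult_left_mono power_mono)
    moreover have "b \<bullet> f p \<le> \<Psi> (f p)"
      using \<delta>(1) by (simp add: \<Psi>_def)
    ultimately show False
      using p1(2)[OF assms(2)] \<delta>(2) by (simp add: \<Psi>_def)
  qed
  then have "\<forall>\<^sub>F q in nhds p1. q \<in> ball 0 1"
    using eventually_nhds_in_open by blast
  then have "\<forall>\<^sub>F q in nhds p1. \<Psi> (f q) \<le> \<Psi> (f p1)"
    by eventually_elim (auto intro: p1(2))
  moreover have "\<not> (\<forall>\<^sub>F q in nhds p1. \<Psi> (f q) \<le> \<Psi> (f p1))"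
  proof (rule no_interior_max[OF \<open>p1 \<in> ball 0 1\<close> open_UNIV UNIV_I])
    show "(\<Psi> has_derivative (\<lambda>v. (b + (2 * \<delta>) *\<^sub>R q) \<bullet> v)) (at q)" for q
      unfolding \<Psi>_def by (auto intro!: derivative_eq_intros simp: fun_eq_iff algebra_simps inner_commute)
    show "((\<lambda>q. b + (2 * \<delta>) *\<^sub>R q) has_derivative (\<lambda>v. (2 * \<delta>) *\<^sub>R v)) (at (f p1))"
      by (auto intro!: derivative_eq_intros)
    show "((2 * \<delta>) *\<^sub>R N) \<bullet> N < (N \<bullet> N) * (\<Sum>b\<in>(Basis::(real^3) set). ((2 * \<delta>) *\<^sub>R b) \<bullet> b)" if "N \<noteq> 0" for N :: "real^3"
      using that \<delta>(1) by (simp add: inner_same_Basis)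
  qed
  ultimately show False by blast
qed

end

section \<open>Bent helicoids as barriers\<close>

text \<open>Here \<open>(g1, \<sigma>, g3)\<close> is the gradient of the barrier \<open>\<Psi>\<close>, and \<open>h11\<close>, \<open>h13\<close>, \<open>h33\<close> are the nonzero entries of its Hessian,
  with \<open>t = tan (a z)\<close>. The left-hand side is \<open>|\<nabla>\<Psi>|\<^sup>2\<close> times the trace of the Hessian over the tangent plane of the
  level set. For \<open>k = \<epsilon> = 0\<close> it vanishes, because the level sets are then translated helicoids. On the right, for positive \<open>k\<close> and \<open>\<epsilon>\<close>, only
  the last summand can be negative, and only for \<open>|t| < 1\<close>, away from the end rulings; there
  \<open>2 k s\<close> dominates if \<open>\<epsilon>\<close> is small.\<close>

lemma barrier_curvature_identity:
  fixes a k \<epsilon> \<sigma> x t s :: real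
  assumes "\<sigma>\<^sup>2 = 1" and s: "s = 1 + t\<^sup>2"
    and g1: "g1 = - \<sigma> * t + 2 * k * x * s"
    and g3: "g3 = - \<sigma> * a * x * s + 2 * k * a * x\<^sup>2 * t * s - \<epsilon> * a * t"
    and h11: "h11 = 2 * k * s"
    and h13: "h13 = - \<sigma> * a * s + 4 * k * a * x * t * s"
    and h33: "h33 = - 2 * \<sigma> * a\<^sup>2 * x * t * s + 2 * k * a\<^sup>2 * x\<^sup>2 * s * (s + 2 * t\<^sup>2) - \<epsilon> * a\<^sup>2 * s"
  shows "h11 * (1 + g3\<^sup>2) - 2 * h13 * g1 * g3 + h33 * (1 + g1\<^sup>2)
    = 2 * k * s + 8 * a\<^sup>2 * k^3 * x^4 * s^3 + 2 * k * s * (\<epsilon> * a * t)\<^sup>2 + \<epsilon> * a\<^sup>2 * (1 + g1\<^sup>2) * (t\<^sup>2 - 1)"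
  using assms(1) unfolding g1 g3 h11 h13 h33 s by algebra

lemma tan_has_derivative:
  assumes "cos (a * (e \<bullet> q - z0)) \<noteq> (0::real)"
  shows "((\<lambda>q. tan (a * (e \<bullet> q - z0))) has_derivative
     (\<lambda>v. a * (1 + (tan (a * (e \<bullet> q - z0)))\<^sup>2) * (e \<bullet> v))) (at q)"
proof -
  have "((\<lambda>q. a * (e \<bullet> q - z0)) has_derivative (\<lambda>v. a * (e \<bullet> v))) (at q)"
    by (auto intro!: derivative_eq_intros)
  from has_derivative_compose[OF this DERIV_tan[OF assms, unfolded has_field_derivative_def]]
  show ?thesis
    using assms by (simp add: tan_sec power_inverse algebra_simps)
qed

lemma ln_cos_has_derivative:
  assumes "cos (a * (e \<bullet> q - z0)) > (0::real)"
  shows "((\<lambda>q. ln (cos (a * (e \<bullet> q - z0)))) has_derivative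
     (\<lambda>v. - a * tan (a * (e \<bullet> q - z0)) * (e \<bullet> v))) (at q)"
proof -
  have "((\<lambda>q. a * (e \<bullet> q - z0)) has_derivative (\<lambda>v. a * (e \<bullet> v))) (at q)"
    by (auto intro!: derivative_eq_intros)
  moreover have "((\<lambda>w. ln (cos w)) has_real_derivative - tan w) (at w)" if "cos w > 0" for w :: real
    using that by (auto intro!: derivative_eq_intros simp: tan_def field_simps)
  ultimately show ?thesis
    using has_derivative_compose[of "\<lambda>q. a * (e \<bullet> q - z0)" _ q UNIV "\<lambda>w. ln (cos w)"] assms
    unfolding has_field_derivative_def by (fastforce simp: algebra_simps)
qed

text \<open>Orthonormal coordinates adapted to the middle ruling. Parseval's identity is recorded together with orthonormality,
  because it expresses the norm of a normal vector in these coordinates.\<close>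

locale frame =
  fixes e1 e2 e3 :: "real^3"
  assumes orthonormal: "e1 \<bullet> e1 = 1" "e2 \<bullet> e2 = 1" "e3 \<bullet> e3 = 1" "e1 \<bullet> e2 = 0" "e1 \<bullet> e3 = 0" "e2 \<bullet> e3 = 0"
    and complete: "\<And>v. v \<bullet> v = (e1 \<bullet> v)\<^sup>2 + (e2 \<bullet> v)\<^sup>2 + (e3 \<bullet> v)\<^sup>2"

locale minimal_disk_in_frame = minimal_disk f + frame e1 e2 e3 for f e1 e2 e3 +
  fixes a z0 :: real
begin

text \<open>The sign \<open>\<sigma>\<close> selects the side of the helicoid that the barrier closes off: the half turn about
  the axis exchanges the two.\<close>

lemma barrier_no_interior_max:
  assumes p: "p \<in> ball 0 1" and cos_pos: "cos (a * (e3 \<bullet> f p - z0)) > 0"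
    and \<sigma>: "\<sigma>\<^sup>2 = 1" and k: "k > 0" and \<epsilon>: "\<epsilon> > 0"
    and small: "5 * \<epsilon> * a\<^sup>2 < 2 * k" "4 * k * \<bar>e1 \<bullet> f p\<bar> \<le> 1"
    and \<Psi>: "\<Psi> = (\<lambda>q. \<sigma> * (e2 \<bullet> q - (e1 \<bullet> q) * tan (a * (e3 \<bullet> q - z0)))
      + k * (e1 \<bullet> q)\<^sup>2 * (1 + (tan (a * (e3 \<bullet> q - z0)))\<^sup>2) + \<epsilon> * ln (cos (a * (e3 \<bullet> q - z0))))"
  shows "\<not> (\<forall>\<^sub>F q in nhds p. \<Psi> (f q) \<le> \<Psi> (f p))"
proof -
  define W where "W = {q. cos (a * (e3 \<bullet> q - z0)) > 0}"
  define T where "T = (\<lambda>q. tan (a * (e3 \<bullet> q - z0)))"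
  define g1 where "g1 = (\<lambda>q. - \<sigma> * T q + 2 * k * (e1 \<bullet> q) * (1 + (T q)\<^sup>2))"
  define g3 where "g3 = (\<lambda>q. - \<sigma> * a * (e1 \<bullet> q) * (1 + (T q)\<^sup>2)
     + 2 * k * a * (e1 \<bullet> q)\<^sup>2 * T q * (1 + (T q)\<^sup>2) - \<epsilon> * a * T q)"
  define G where "G = (\<lambda>q. g1 q *\<^sub>R e1 + \<sigma> *\<^sub>R e2 + g3 q *\<^sub>R e3)"
  define x t where "x = e1 \<bullet> f p" and "t = T (f p)"
  define s where "s = 1 + t\<^sup>2"
  define h11 h13 h33 where "h11 = 2 * k * s" and "h13 = - \<sigma> * a * s + 4 * k * a * x * t * s"
    and "h33 = - 2 * \<sigma> * a\<^sup>2 * x * t * s + 2 * k * a\<^sup>2 * x\<^sup>2 * s * (s + 2 * t\<^sup>2) - \<epsilon> * a\<^sup>2 * s"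
  define H where "H = (\<lambda>v. (h11 * (e1 \<bullet> v) + h13 * (e3 \<bullet> v)) *\<^sub>R e1 + (h13 * (e1 \<bullet> v) + h33 * (e3 \<bullet> v)) *\<^sub>R e3)"
  have T: "(T has_derivative (\<lambda>v. a * (1 + (T q)\<^sup>2) * (e3 \<bullet> v))) (at q)" if "q \<in> W" for q
    using tan_has_derivative[of a e3 q z0] that unfolding T_def W_def by simp
  have W: "open W" "f p \<in> W"
    unfolding W_def using cos_pos by (auto intro!: open_Collect_less continuous_intros)
  have g1': "(g1 has_derivative (\<lambda>v. h11 * (e1 \<bullet> v) + h13 * (e3 \<bullet> v))) (at (f p))"
    unfolding g1_def
    by (rule has_derivative_eq_rhs, (rule derivative_eq_intros T[OF W(2)] refl)+)
      (simp add: fun_eq_iff h11_def h13_def s_def x_def t_def algebra_simps power2_eq_square)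
  have g3': "(g3 has_derivative (\<lambda>v. h13 * (e1 \<bullet> v) + h33 * (e3 \<bullet> v))) (at (f p))"
    unfolding g3_def
    by (rule has_derivative_eq_rhs, (rule derivative_eq_intros T[OF W(2)] refl)+)
      (simp add: fun_eq_iff h33_def h13_def s_def x_def t_def algebra_simps power2_eq_square)
  show ?thesis
  proof (rule no_interior_max[OF p W])
    fix q assume "q \<in> W"
    define L where "L = (\<lambda>q. ln (cos (a * (e3 \<bullet> q - z0))))"
    have L: "(L has_derivative (\<lambda>v. - a * T q * (e3 \<bullet> v))) (at q)"
      using ln_cos_has_derivative[of a e3 q z0] \<open>q \<in> W\<close> by (simp add: W_def T_def L_def)
    have \<Psi>': "\<Psi> = (\<lambda>q. \<sigma> * (e2 \<bullet> q - (e1 \<bullet> q) * T q) + k * (e1 \<bullet> q)\<^sup>2 * (1 + (T q)\<^sup>2) + \<epsilon> * L q)"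
      by (simp add: \<Psi> T_def L_def)
    show "(\<Psi> has_derivative (\<lambda>v. G q \<bullet> v)) (at q)"
      unfolding \<Psi>'
      by (rule has_derivative_eq_rhs, (rule derivative_eq_intros L T[OF \<open>q \<in> W\<close>] refl)+)
        (simp add: fun_eq_iff G_def g1_def g3_def inner_add_left algebra_simps power2_eq_square)
  next
    show "(G has_derivative H) (at (f p))"
      unfolding G_def H_def
      by (rule has_derivative_eq_rhs, (rule derivative_eq_intros g1' g3' refl)+)
        (simp add: fun_eq_iff)
  next
    fix N c assume "N \<noteq> 0" and c: "G (f p) = c *\<^sub>R N"
    define n1 n2 n3 where "n1 = e1 \<bullet> N" and "n2 = e2 \<bullet> N" and "n3 = e3 \<bullet> N"
    have "e1 \<bullet> G (f p) = g1 (f p)" "e2 \<bullet> G (f p) = \<sigma>" "e3 \<bullet> G (f p) = g3 (f p)"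
      by (simp_all add: G_def inner_add_right orthonormal inner_commute[of e2 e1] inner_commute[of e3 e1] inner_commute[of e3 e2])
    then have n: "g1 (f p) = c * n1" "\<sigma> = c * n2" "g3 (f p) = c * n3"
      by (simp_all add: c n1_def n2_def n3_def)
    have "c \<noteq> 0" using n(2) \<sigma> by auto
    have tr: "(\<Sum>b\<in>Basis. H b \<bullet> b) = h11 + h33"
    proof -
      have "(\<Sum>b\<in>Basis. H b \<bullet> b) = h11 * (\<Sum>b\<in>Basis. (e1 \<bullet> b) * (e1 \<bullet> b)) + 2 * h13 * (\<Sum>b\<in>Basis. (e1 \<bullet> b) * (e3 \<bullet> b))
         + h33 * (\<Sum>b\<in>Basis. (e3 \<bullet> b) * (e3 \<bullet> b))"
        by (simp add: H_def inner_add_left sum_distrib_left sum.distrib[symmetric] algebra_simps)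
      then show ?thesis
        by (simp add: euclidean_inner[symmetric] orthonormal)
    qed
    have HN: "H N \<bullet> N = h11 * n1\<^sup>2 + 2 * h13 * n1 * n3 + h33 * n3\<^sup>2"
      by (simp add: H_def n1_def n3_def inner_add_left algebra_simps power2_eq_square)
    have NN: "N \<bullet> N = n1\<^sup>2 + n2\<^sup>2 + n3\<^sup>2"
      using complete[of N] by (simp add: n1_def n2_def n3_def)
    have "0 < h11 * (1 + (g3 (f p))\<^sup>2) - 2 * h13 * g1 (f p) * g3 (f p) + h33 * (1 + (g1 (f p))\<^sup>2)"
    proof -
      have "h11 * (1 + (g3 (f p))\<^sup>2) - 2 * h13 * g1 (f p) * g3 (f p) + h33 * (1 + (g1 (f p))\<^sup>2)
        = 2 * k * s + 8 * a\<^sup>2 * k^3 * x^4 * s^3 + 2 * k * s * (\<epsilon> * a * t)\<^sup>2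
          + \<epsilon> * a\<^sup>2 * (1 + (g1 (f p))\<^sup>2) * (t\<^sup>2 - 1)"
        by (rule barrier_curvature_identity[OF \<sigma> s_def _ _ h11_def h13_def h33_def])
          (simp_all add: g1_def g3_def x_def t_def s_def)
      moreover have "s \<ge> 1" by (simp add: s_def)
      moreover have "8 * a\<^sup>2 * k^3 * x^4 * s^3 \<ge> 0" "2 * k * s * (\<epsilon> * a * t)\<^sup>2 \<ge> 0" "2 * k * s \<ge> 2 * k"
        using k \<open>s \<ge> 1\<close> by simp_all
      moreover have "\<epsilon> * a\<^sup>2 * (1 + (g1 (f p))\<^sup>2) * (t\<^sup>2 - 1) > - 2 * k"
      proof (cases "t\<^sup>2 \<ge> 1")
        case True
        then have "\<epsilon> * a\<^sup>2 * (1 + (g1 (f p))\<^sup>2) * (t\<^sup>2 - 1) \<ge> 0"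
          using \<epsilon> by simp
        then show ?thesis using k by linarith
      next
        case False
        then have "\<bar>t\<bar> \<le> 1" using abs_square_le_1[of t] by linarith
        moreover have "\<bar>2 * k * x * s\<bar> \<le> 1"
        proof -
          have "2 * k * \<bar>x\<bar> * s \<le> 2 * k * \<bar>x\<bar> * 2"
            using False k by (intro mult_left_mono) (auto simp: s_def)
          also have "\<dots> \<le> 1" using small(2) by (simp add: x_def)
          finally show ?thesis using k \<open>s \<ge> 1\<close> by (simp add: abs_mult)
        qed
        moreover have "\<bar>\<sigma>\<bar> = 1" using \<sigma> by (simp add: power2_eq_1_iff) auto
        ultimately have "\<bar>g1 (f p)\<bar> \<le> 2"
          unfolding g1_def x_def[symmetric] t_def[symmetric] s_def[symmetric]
          by (smt (verit) abs_mult abs_minus mult_cancel_right1 mult_minus_left)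
        \<comment> \<open>together with \<open>1 - t\<^sup>2 \<le> 1\<close> the source of the factor 5 in the smallness condition\<close>
        then have "1 + (g1 (f p))\<^sup>2 \<le> 5"
          using abs_le_square_iff[of "g1 (f p)" 2] by simp
        then have "(1 + (g1 (f p))\<^sup>2) * (1 - t\<^sup>2) \<le> 5 * 1"
          using False by (intro mult_mono) auto
        then have "\<epsilon> * a\<^sup>2 * ((1 + (g1 (f p))\<^sup>2) * (1 - t\<^sup>2)) \<le> \<epsilon> * a\<^sup>2 * (5 * 1)"
          using \<epsilon> by (intro mult_left_mono) auto
        then show ?thesis using small(1) by (simp add: algebra_simps)
      qed
      ultimately show ?thesis by linarith
    qed
    also have "\<dots> = h11 * (\<sigma>\<^sup>2 + (g3 (f p))\<^sup>2) - 2 * h13 * g1 (f p) * g3 (f p) + h33 * (\<sigma>\<^sup>2 + (g1 (f p))\<^sup>2)"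
      by (simp add: \<sigma>)
    also have "\<dots> = c\<^sup>2 * ((N \<bullet> N) * (h11 + h33) - H N \<bullet> N)"
      unfolding n HN NN by (simp add: algebra_simps power2_eq_square)
    finally show "H N \<bullet> N < (N \<bullet> N) * (\<Sum>b\<in>Basis. H b \<bullet> b)"
      unfolding tr by (simp add: zero_less_mult_iff)
  qed
qed

text \<open>If the disk left the closed side of the helicoid at \<open>p0\<close>, then \<open>\<Psi>\<close> would have an interior maximum as soon as \<open>k\<close> and \<open>\<epsilon>\<close>
  are small compared with the height of \<open>p0\<close> above the helicoid. At points where the cosine vanishes
  \<open>tan\<close> is singular, but the bound of \<open>x\<close> by \<open>K cos (a z)\<close> keeps \<open>\<Psi> - \<epsilon> ln (cos (a z))\<close> below a constant
  near them, so that \<open>\<Psi>\<close> tends to \<open>-\<infinity>\<close> and its maximum is attained elsewhere.\<close>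

lemma one_sided_bound:
  assumes "r > 0" "K > 0" and \<sigma>: "\<sigma>\<^sup>2 = 1"
    and cos_nonneg: "\<And>p. p \<in> cball 0 1 \<Longrightarrow> cos (a * (e3 \<bullet> f p - z0)) \<ge> 0"
    and bound: "\<And>p. p \<in> cball 0 1 \<Longrightarrow> \<bar>e1 \<bullet> f p\<bar> \<le> r"
       "\<And>p. p \<in> cball 0 1 \<Longrightarrow> \<bar>e2 \<bullet> f p\<bar> \<le> r"
       "\<And>p. p \<in> cball 0 1 \<Longrightarrow> \<bar>e1 \<bullet> f p\<bar> \<le> K * cos (a * (e3 \<bullet> f p - z0))"
    and boundary: "\<And>p. p \<in> sphere 0 1 \<Longrightarrow>
         (e2 \<bullet> f p) * cos (a * (e3 \<bullet> f p - z0)) = (e1 \<bullet> f p) * sin (a * (e3 \<bullet> f p - z0))"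
       "\<And>p. p \<in> sphere 0 1 \<Longrightarrow> \<bar>e1 \<bullet> f p\<bar> \<le> r * cos (a * (e3 \<bullet> f p - z0))"
    and p0: "p0 \<in> cball 0 1" "cos (a * (e3 \<bullet> f p0 - z0)) > 0"
  shows "\<sigma> * (e2 \<bullet> f p0 - (e1 \<bullet> f p0) * tan (a * (e3 \<bullet> f p0 - z0))) \<le> 0"
proof (rule ccontr)
  define C where "C = (\<lambda>q. cos (a * (e3 \<bullet> q - z0)))"
  define m where "m = \<sigma> * (e2 \<bullet> f p0 - (e1 \<bullet> f p0) * tan (a * (e3 \<bullet> f p0 - z0)))"
  assume "\<not> ?thesis"
  then have m: "m > 0" by (simp add: m_def)
  \<comment> \<open>\<open>k\<close> keeps \<open>\<Psi>\<close> below \<open>m / 2\<close> on the boundary; \<open>\<epsilon>\<close> keeps it above \<open>m / 2\<close> at \<open>p0\<close> and satisfies the smallness condition of the barrier\<close>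
  define k where "k = min (1 / (4 * r)) (m / (4 * r\<^sup>2))"
  have "k \<le> 1 / (4 * r)" "k \<le> m / (4 * r\<^sup>2)" by (simp_all add: k_def)
  moreover have "k > 0"
    using \<open>r > 0\<close> m by (simp add: k_def)
  ultimately have k: "k > 0" "4 * k * r \<le> 1" "k * r\<^sup>2 < m / 2"
    using \<open>r > 0\<close> m by (simp_all add: field_simps)
  define \<beta> where "\<beta> = - ln (C (f p0))"
  have \<beta>: "\<beta> \<ge> 0" using p0(2) by (simp add: \<beta>_def C_def)
  define \<epsilon> where "\<epsilon> = min (m / (2 * (\<beta> + 1))) (k / (5 * a\<^sup>2 + 1))"
  have "5 * a\<^sup>2 + 1 > 0" by (simp add: add_nonneg_pos)
  then have \<epsilon>0: "\<epsilon> > 0" using m k \<beta> by (simp add: \<epsilon>_def)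
  have \<epsilon>1: "\<epsilon> * \<beta> < m / 2"
  proof -
    have "\<epsilon> * (\<beta> + 1) \<le> m / (2 * (\<beta> + 1)) * (\<beta> + 1)"
      using \<beta> by (intro mult_right_mono) (auto simp: \<epsilon>_def)
    also have "\<dots> = m / 2"
      using \<beta> by (simp add: field_simps)
    finally show ?thesis using \<epsilon>0 by (simp add: algebra_simps)
  qed
  have \<epsilon>2: "5 * \<epsilon> * a\<^sup>2 < 2 * k"
  proof -
    have "\<epsilon> * (5 * a\<^sup>2 + 1) \<le> k / (5 * a\<^sup>2 + 1) * (5 * a\<^sup>2 + 1)"
      using \<open>5 * a\<^sup>2 + 1 > 0\<close> by (intro mult_right_mono) (auto simp: \<epsilon>_def)
    also have "\<dots> = k"
      using \<open>5 * a\<^sup>2 + 1 > 0\<close> by simp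
    finally show ?thesis using \<epsilon>0 k(1) by (simp add: algebra_simps)
  qed
  define \<Psi> where "\<Psi> = (\<lambda>q. \<sigma> * (e2 \<bullet> q - (e1 \<bullet> q) * tan (a * (e3 \<bullet> q - z0)))
      + k * (e1 \<bullet> q)\<^sup>2 * (1 + (tan (a * (e3 \<bullet> q - z0)))\<^sup>2) + \<epsilon> * ln (cos (a * (e3 \<bullet> q - z0))))"
  have sec: "k * (e1 \<bullet> q)\<^sup>2 * (1 + (tan (a * (e3 \<bullet> q - z0)))\<^sup>2) \<le> k * L\<^sup>2"
    if "C q > 0" "\<bar>e1 \<bullet> q\<bar> \<le> L * C q" for q L
  proof -
    have "(e1 \<bullet> q)\<^sup>2 * (1 + (tan (a * (e3 \<bullet> q - z0)))\<^sup>2) = (\<bar>e1 \<bullet> q\<bar> / C q)\<^sup>2"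
      using that(1) tan_sec[of "a * (e3 \<bullet> q - z0)"] by (simp add: C_def power_divide inverse_eq_divide power_inverse)
    also have "\<dots> \<le> L\<^sup>2"
      using that by (intro power_mono) (auto simp: divide_le_eq)
    finally show ?thesis using k(1) by (simp add: mult.assoc)
  qed
  have \<sigma>1: "\<sigma> * w \<le> \<bar>w\<bar>" for w
    using \<sigma> by (auto simp: power2_eq_1_iff)
  define B where "B = r + K + k * K\<^sup>2"
  have upper: "\<Psi> (f p) \<le> B + \<epsilon> * ln (C (f p))" if "p \<in> cball 0 1" "C (f p) > 0" for p
  proof -
    have "\<bar>(e1 \<bullet> f p) * tan (a * (e3 \<bullet> f p - z0))\<bar> \<le> K"
    proof -
      have "\<bar>(e1 \<bullet> f p) * tan (a * (e3 \<bullet> f p - z0))\<bar> = \<bar>e1 \<bullet> f p\<bar> * \<bar>sin (a * (e3 \<bullet> f p - z0))\<bar> / C (f p)"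
        using that(2) by (simp add: tan_def C_def abs_mult)
      also have "\<dots> \<le> (K * C (f p)) * 1 / C (f p)"
        using bound(3)[OF that(1)] that(2) \<open>K > 0\<close> by (intro divide_right_mono mult_mono) (auto simp: C_def)
      finally show ?thesis using that(2) by simp
    qed
    then have "\<sigma> * (e2 \<bullet> f p - (e1 \<bullet> f p) * tan (a * (e3 \<bullet> f p - z0))) \<le> r + K"
      using bound(2)[OF that(1)] \<sigma>1[of "e2 \<bullet> f p - (e1 \<bullet> f p) * tan (a * (e3 \<bullet> f p - z0))"] by linarith
    then show ?thesis
      using sec[OF that(2), of K] bound(3)[OF that(1)] by (simp add: \<Psi>_def B_def C_def)
  qed
  have start: "\<Psi> (f p0) > m / 2"
  proof -
    have "k * (e1 \<bullet> f p0)\<^sup>2 * (1 + (tan (a * (e3 \<bullet> f p0 - z0)))\<^sup>2) \<ge> 0"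
      using k(1) by simp
    then show ?thesis using \<epsilon>1 by (simp add: \<Psi>_def m_def \<beta>_def C_def)
  qed
  \<comment> \<open>\<open>\<Psi>\<close> is negative where the cosine is below \<open>\<delta>\<close>, so the maximum may be sought on the compact set where it is at least \<open>\<delta>\<close>\<close>
  define \<delta> where "\<delta> = exp (- (B / \<epsilon>))"
  have low: "\<Psi> (f p) < 0" if "p \<in> cball 0 1" "0 < C (f p)" "C (f p) < \<delta>" for p
  proof -
    have "ln (C (f p)) < - (B / \<epsilon>)"
      using that by (metis \<delta>_def exp_gt_zero ln_exp ln_less_cancel_iff)
    then have "\<epsilon> * ln (C (f p)) < - B"
      using \<epsilon>0 by (simp add: field_simps)
    then show ?thesis using upper[OF that(1,2)] by simp
  qed
  have contC: "continuous_on (cball 0 1) (\<lambda>p. C (f p))"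
    unfolding C_def by (intro continuous_intros continuous)
  define S where "S = cball 0 1 \<inter> (\<lambda>p. C (f p)) -` {\<delta>..}"
  have SC: "p \<in> cball 0 1" "C (f p) \<ge> \<delta>" "C (f p) > 0" if "p \<in> S" for p
    using that unfolding S_def \<delta>_def by (auto intro: less_le_trans[OF exp_gt_zero])
  have "compact S"
    unfolding S_def compact_eq_bounded_closed
    using continuous_closed_preimage[OF contC closed_cball closed_atLeast] bounded_subset[OF bounded_cball] by blast
  moreover have "continuous_on S (\<lambda>p. \<Psi> (f p))"
  proof -
    have "continuous_on S f"
      by (rule continuous_on_subset[OF continuous]) (auto simp: S_def)
    moreover have "cos (a * (e3 \<bullet> f p - z0)) \<noteq> 0" if "p \<in> S" for p
      using SC(3)[OF that] by (simp add: C_def)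
    ultimately show ?thesis
      unfolding \<Psi>_def tan_def by (intro continuous_intros ballI) auto
  qed
  moreover have "p0 \<in> S"
    using low[of p0] start m p0 unfolding S_def by (force simp: C_def)
  ultimately obtain p1 where p1: "p1 \<in> S" "\<And>p. p \<in> S \<Longrightarrow> \<Psi> (f p) \<le> \<Psi> (f p1)"
    using continuous_attains_sup[of S "\<lambda>p. \<Psi> (f p)"] by blast
  have big: "\<Psi> (f p1) > m / 2" using p1(2)[OF \<open>p0 \<in> S\<close>] start by simp
  have "p1 \<in> ball 0 1"
  proof (rule ccontr)
    assume "p1 \<notin> ball 0 1"
    then have s: "p1 \<in> sphere 0 1" using SC(1)[OF p1(1)] by simp
    have "e2 \<bullet> f p1 = (e1 \<bullet> f p1) * tan (a * (e3 \<bullet> f p1 - z0))"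
      using boundary(1)[OF s] SC(3)[OF p1(1)] by (simp add: tan_def C_def field_simps)
    moreover have "ln (C (f p1)) \<le> 0" using SC(3)[OF p1(1)] by (simp add: C_def)
    ultimately have "\<Psi> (f p1) \<le> k * r\<^sup>2"
      using sec[OF SC(3)[OF p1(1)], of r] boundary(2)[OF s] \<epsilon>0
      by (simp add: \<Psi>_def C_def) (smt (verit) mult_nonneg_nonpos)
    then show False using big k(3) by simp
  qed
  have "\<not> (\<forall>\<^sub>F q in nhds p1. \<Psi> (f q) \<le> \<Psi> (f p1))"
  proof (rule barrier_no_interior_max[OF \<open>p1 \<in> ball 0 1\<close> _ \<sigma> k(1) \<epsilon>0 \<epsilon>2 _ \<Psi>_def])
    show "cos (a * (e3 \<bullet> f p1 - z0)) > 0" using SC(3)[OF p1(1)] by (simp add: C_def)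
    have "4 * k * \<bar>e1 \<bullet> f p1\<bar> \<le> 4 * k * r"
      using bound(1)[OF SC(1)[OF p1(1)]] k(1) by simp
    then show "4 * k * \<bar>e1 \<bullet> f p1\<bar> \<le> 1" using k(2) by linarith
  qed
  moreover have "\<forall>\<^sub>F q in nhds p1. \<Psi> (f q) \<le> \<Psi> (f p1)"
  proof -
    have "\<forall>\<^sub>F q in nhds p1. q \<in> ball 0 1"
      using \<open>p1 \<in> ball 0 1\<close> eventually_nhds_in_open by blast
    moreover have "\<forall>\<^sub>F q in nhds p1. C (f q) > 0"
    proof -
      have "isCont (\<lambda>p. C (f p)) p1"
        using contC \<open>p1 \<in> ball 0 1\<close> by (simp add: continuous_on_interior)
      then have "((\<lambda>p. C (f p)) \<longlongrightarrow> C (f p1)) (nhds p1)"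
        using tendsto_at_iff_tendsto_nhds[of "\<lambda>p. C (f p)" p1] by (simp add: isCont_def)
      then show ?thesis
        using order_tendstoD(1) SC(3)[OF p1(1)] by blast
    qed
    ultimately show ?thesis
    proof eventually_elim
      case (elim q)
      show ?case
      proof (cases "C (f q) \<ge> \<delta>")
        case True
        then show ?thesis using elim p1(2)[of q] by (simp add: S_def)
      next
        case False
        then show ?thesis using low[of q] elim big m by auto
      qed
    qed
  qed
  ultimately show False by blast
qed

end

section \<open>Maps of a disk onto a helicoid\<close>

text \<open>If the point \<open>m w\<close> were omitted, pull the map back to \<open>R\<close>, push it away from \<open>w\<close> onto the frontier of \<open>R\<close>, and
  return to the circle by the inverse of \<open>f\<close> there; the result is a retraction of the disk onto its boundary.\<close>

lemma disk_map_onto_convex_patch: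
  fixes f :: "real^2 \<Rightarrow> 'a::t2_space" and m :: "'b::euclidean_space \<Rightarrow> 'a"
  assumes f: "continuous_on (cball 0 1) f" "f ` cball 0 1 \<subseteq> m ` R"
    and bd: "bij_betw f (sphere 0 1) (m ` frontier R)"
    and m: "continuous_on R m" "inj_on m R"
    and R: "compact R" "convex R" "interior R \<noteq> {}"
  shows "f ` cball 0 1 = m ` R"
proof (rule ccontr)
  assume "f ` cball 0 1 \<noteq> m ` R"
  then obtain w where w: "w \<in> R" "m w \<notin> f ` cball 0 1"
    using f(2) by auto
  have fr: "frontier R \<subseteq> R" using R(1) compact_imp_closed frontier_subset_eq by blast
  have "m ` frontier R \<subseteq> f ` cball 0 1"
    using bd sphere_cball unfolding bij_betw_def by blast
  then have "w \<notin> frontier R" using w by auto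
  then have wi: "w \<in> interior R" using w(1) closure_subset by (auto simp: frontier_def)
  have ri: "rel_frontier R = frontier R" "rel_interior R = interior R" "affine hull R = UNIV"
    using R(3) by (auto simp: rel_frontier_nonempty_interior rel_interior_nonempty_interior affine_hull_nonempty_interior)
  obtain \<rho> where \<rho>: "continuous_on (UNIV - {w}) \<rho>" "\<rho> ` (UNIV - {w}) \<subseteq> frontier R" "\<And>x. x \<in> frontier R \<Longrightarrow> \<rho> x = x"
    using rel_frontier_retract_of_punctured_affine_hull[of R w] compact_imp_bounded[OF R(1)] R(2) wi
    unfolding ri retract_of_def retraction_def image_subset_iff_funcset by blast
  define g where "g = the_inv_into R m"
  have g: "continuous_on (m ` R) g" "\<And>x. x \<in> R \<Longrightarrow> g (m x) = x"
    unfolding g_def using continuous_on_inv_into m R(1)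
    by (auto simp: the_inv_into_f_f intro: continuous_on_inv)
  define j where "j = the_inv_into (sphere 0 1) f"
  have inj: "inj_on f (sphere 0 1)" and im: "f ` sphere 0 1 = m ` frontier R"
    using bd by (auto simp: bij_betw_def)
  have fs: "continuous_on (sphere 0 1) f"
    using f(1) continuous_on_subset sphere_cball by blast
  have jf: "j (f x) = x" if "x \<in> sphere 0 1" for x
    using that inj by (simp add: j_def the_inv_into_f_f)
  have j: "continuous_on (m ` frontier R) j"
    using continuous_on_inv[OF fs compact_sphere, of j] jf im by simp
  have gf: "g (f x) \<in> UNIV - {w}" if "x \<in> cball 0 1" for x
  proof -
    have "f x \<in> m ` R" using f(2) that by (simp add: image_subset_iff)
    then obtain y where "y \<in> R" "f x = m y" by (elim imageE) simp
    moreover have "f x \<in> f ` cball 0 1" using that by blast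
    ultimately have "y \<noteq> w" "g (f x) = y" using w(2) g(2)[of y] by metis+
    then show ?thesis by simp
  qed
  have "continuous_on (cball 0 1) (\<lambda>x. g (f x))"
    by (rule continuous_on_compose2[OF g(1) f(1) f(2)])
  then have c\<rho>: "continuous_on (cball 0 1) (\<lambda>x. \<rho> (g (f x)))"
    by (rule continuous_on_compose2[OF \<rho>(1)]) (use gf in blast)
  have rg: "\<rho> (g (f x)) \<in> frontier R" if "x \<in> cball 0 1" for x
    using gf[OF that] \<rho>(2) by blast
  have cm: "continuous_on (cball 0 1) (\<lambda>x. m (\<rho> (g (f x))))"
    by (rule continuous_on_compose2[OF m(1) c\<rho>]) (use rg fr in blast)
  have "continuous_on (cball 0 1) (\<lambda>x. j (m (\<rho> (g (f x)))))"
    by (rule continuous_on_compose2[OF j cm]) (use rg in blast)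
  moreover have "j (m (\<rho> (g (f x)))) \<in> sphere 0 1" if "x \<in> cball 0 1" for x
  proof -
    have "m (\<rho> (g (f x))) \<in> f ` sphere 0 1" using rg[OF that] im by blast
    then show ?thesis using jf by auto
  qed
  moreover have "j (m (\<rho> (g (f x)))) = x" if x: "x \<in> sphere 0 1" for x
  proof -
    obtain y where "y \<in> frontier R" "f x = m y" using im x by blast
    then have "m (\<rho> (g (f x))) = f x"
      using g(2)[of y] fr \<rho>(3) by auto
    then show ?thesis using jf[OF x] by simp
  qed
  ultimately have "retraction (cball 0 1) (sphere 0 1) (\<lambda>x. j (m (\<rho> (g (f x)))))"
    unfolding retraction_def by auto
  then have "frontier (cball (0::real^2) 1) retract_of cball 0 1"
    unfolding retract_of_def by auto
  then show False using no_retraction_cball[of 1 "0::real^2"] by simp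
qed

lemma cyl_nth [simp]: "cyl s \<phi> z $ 1 = s * cos \<phi>" "cyl s \<phi> z $ 2 = s * sin \<phi>" "cyl s \<phi> z $ 3 = z"
  by (simp_all add: cyl_def)

lemma cyl_eq_iff: "cyl s \<alpha> z = cyl s' \<beta> z' \<longleftrightarrow> s * cos \<alpha> = s' * cos \<beta> \<and> s * sin \<alpha> = s' * sin \<beta> \<and> z = z'"
  by (simp add: vec_eq_iff forall_3)

lemma cyl_rotate:
  assumes "cyl s \<alpha> z = cyl s' \<beta> z'"
  shows "cyl s (\<alpha> + w) y = cyl s' (\<beta> + w) y"
proof -
  have "s * cos \<alpha> = s' * cos \<beta>" "s * sin \<alpha> = s' * sin \<beta>"
    using assms by (auto simp: cyl_eq_iff)
  then show ?thesis
    unfolding cyl_eq_iff cos_add sin_add by algebra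
qed

definition helicoid_map :: "real \<Rightarrow> real \<Rightarrow> real \<Rightarrow> real \<times> real \<Rightarrow> real^3" where
  "helicoid_map h \<phi> \<theta> = (\<lambda>(s, z). cyl s (\<phi> + \<theta> * z / h) z)"

lemma helicoid_piece_eq_image:
  "helicoid_piece r h \<phi> \<theta> = helicoid_map h \<phi> \<theta> ` cbox (-r, 0) (r, h)"
  unfolding helicoid_piece_def helicoid_map_def cbox_Pair_eq by (force simp: abs_le_iff)

lemma continuous_on_helicoid_map: "continuous_on A (helicoid_map h \<phi> \<theta>)"
proof -
  have "helicoid_map h \<phi> \<theta> = (\<lambda>x. \<chi> i. if i = 1 then fst x * cos (\<phi> + \<theta> * snd x / h)
     else if i = 2 then fst x * sin (\<phi> + \<theta> * snd x / h) else snd x)"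
    by (auto simp: helicoid_map_def fun_eq_iff vec_eq_iff forall_3)
  moreover have "continuous_on A (\<lambda>x. if i = 1 then fst x * cos (\<phi> + \<theta> * snd x / h)
     else if i = 2 then fst x * sin (\<phi> + \<theta> * snd x / h) else snd x)" for i :: 3
    using exhaust_3[of i] by (auto simp: divide_inverse intro!: continuous_intros)
  ultimately show ?thesis by (simp add: continuous_on_vec_lambda)
qed

lemma inj_helicoid_map: "inj (helicoid_map h \<phi> \<theta>)"
proof (rule injI)
  fix p q assume eq: "helicoid_map h \<phi> \<theta> p = helicoid_map h \<phi> \<theta> q"
  obtain s z s' z' where pq: "p = (s, z)" "q = (s', z')" by fastforce
  define c where "c = \<phi> + \<theta> * z / h"
  have "s * cos c = s' * cos c" "s * sin c = s' * sin c" "z = z'"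
    using eq by (auto simp: pq helicoid_map_def cyl_eq_iff c_def)
  moreover have "cos c \<noteq> 0 \<or> sin c \<noteq> 0"
    using sin_zero_abs_cos_one[of c] by auto
  ultimately show "p = q" by (auto simp: pq)
qed

lemma frontier_rectangle:
  assumes "r > (0::real)" "h > (0::real)"
  shows "frontier (cbox (-r, 0) (r, h)) = {-r..r} \<times> {0, h} \<union> {-r, r} \<times> {0..h}"
  using assms by (auto simp: frontier_def cbox_Pair_eq interior_Times closure_Times)

text \<open>The end heights fix the pitch and the rotation angle fixes the angular speed, so the helix is a boundary
  line of the helicoid; which one depends on the end of the bottom diameter at which it starts.\<close>

lemma helix_path_image:
  assumes "r > 0" "h > 0" "helix r \<gamma>" "rot r \<gamma> = \<theta>"
    and "pathstart \<gamma> \<in> diameter_ends r 0 \<phi>" "pathfinish \<gamma> \<in> diameter_ends r h \<psi>"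
  obtains \<rho> where "\<rho> \<in> {-r, r}" "pathstart \<gamma> = helicoid_map h \<phi> \<theta> (\<rho>, 0)"
    "pathfinish \<gamma> = helicoid_map h \<phi> \<theta> (\<rho>, h)"
    "path_image \<gamma> = helicoid_map h \<phi> \<theta> ` ({\<rho>} \<times> {0..h})"
proof -
  obtain \<alpha> \<omega> c k where \<gamma>: "\<And>t. t \<in> {0..1} \<Longrightarrow> \<gamma> t = cyl r (\<alpha> + \<omega> * t) (c + k * t)"
    using assms(3) unfolding helix_def by blast
  have "\<omega> = \<theta>" using rot_helix[OF assms(1) \<gamma>] assms(4) by simp
  have s: "pathstart \<gamma> = cyl r \<alpha> c" "pathfinish \<gamma> = cyl r (\<alpha> + \<omega>) (c + k)"
    using \<gamma>[of 0] \<gamma>[of 1] by (simp_all add: pathstart_def pathfinish_def)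
  have c: "c = 0" "k = h"
    using assms(5,6) unfolding s diameter_ends_def by (auto simp: cyl_eq_iff)
  obtain \<rho> where \<rho>: "\<rho> \<in> {-r, r}" "cyl r \<alpha> 0 = cyl \<rho> \<phi> 0"
    using assms(5) unfolding s diameter_ends_def c by auto
  have t: "\<gamma> t = helicoid_map h \<phi> \<theta> (\<rho>, h * t)" if "t \<in> {0..1}" for t
    using \<gamma>[OF that] cyl_rotate[OF \<rho>(2), of "\<theta> * t" "h * t"] \<open>h > 0\<close>
    by (simp add: helicoid_map_def c \<open>\<omega> = \<theta>\<close>)
  have "{0..h} = (*) h ` {0..1}"
    using \<open>h > 0\<close> image_mult_atLeastAtMost[of h 0 1] by simp
  then have "path_image \<gamma> = helicoid_map h \<phi> \<theta> ` ({\<rho>} \<times> {0..h})"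
    unfolding path_image_def using t by force
  then show ?thesis
    using that \<rho>(1) t[of 0] t[of 1] by (simp add: pathstart_def pathfinish_def)
qed

text \<open>The two helices start at different ends of the bottom diameter and thus are the two boundary helices of
  the helicoid. Their upper end points determine the top diameter, so that its direction angle agrees with
  that of the top ruling up to a multiple of \<open>\<pi>\<close>.\<close>

lemma boundary_curve:
  assumes "r > 0" "h > 0" "double_helix r h1 h2"
    and "{pathstart h1, pathstart h2} = diameter_ends r 0 \<phi>2"
    and "{pathfinish h1, pathfinish h2} = diameter_ends r h \<phi>1"
    and "rot r h1 = \<theta>" "rot r h2 = \<theta>"
  shows "diameter_at r h \<phi>1 \<union> diameter_at r 0 \<phi>2 \<union> path_image h1 \<union> path_image h2
    = helicoid_map h \<phi>2 \<theta> ` frontier (cbox (-r, 0) (r, h))"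
proof -
  let ?m = "helicoid_map h \<phi>2 \<theta>"
  obtain \<rho>1 where 1: "\<rho>1 \<in> {-r, r}" "pathstart h1 = ?m (\<rho>1, 0)" "pathfinish h1 = ?m (\<rho>1, h)"
    "path_image h1 = ?m ` ({\<rho>1} \<times> {0..h})"
    by (rule helix_path_image[OF assms(1,2) _ assms(6), of \<phi>2 \<phi>1])
      (use assms(3-5) in \<open>auto simp: double_helix_def\<close>)
  obtain \<rho>2 where 2: "\<rho>2 \<in> {-r, r}" "pathstart h2 = ?m (\<rho>2, 0)" "pathfinish h2 = ?m (\<rho>2, h)"
    "path_image h2 = ?m ` ({\<rho>2} \<times> {0..h})"
    by (rule helix_path_image[OF assms(1,2) _ assms(7), of \<phi>2 \<phi>1])
      (use assms(3-5) in \<open>auto simp: double_helix_def\<close>)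
  have "{?m (\<rho>1, 0), ?m (\<rho>2, 0)} = {?m (r, 0), ?m (-r, 0)}"
    using assms(4) unfolding 1(2) 2(2) diameter_ends_def by (simp add: helicoid_map_def)
  then have \<rho>: "{\<rho>1, \<rho>2} = {-r, r}"
    using inj_helicoid_map[of h \<phi>2 \<theta>] by (auto simp: doubleton_eq_iff inj_eq)
  have bottom: "diameter_at r 0 \<phi>2 = ?m ` ({-r..r} \<times> {0})"
  proof -
    have "{-r..r} \<times> {0} = (\<lambda>s. (s, 0::real)) ` {-r..r}" by auto
    then have "?m ` ({-r..r} \<times> {0}) = (\<lambda>s. cyl s \<phi>2 0) ` {-r..r}"
      by (simp add: image_image helicoid_map_def)
    then show ?thesis by (auto simp: diameter_at_def abs_le_iff)
  qed
  have "cyl r \<phi>1 h \<in> {?m (\<rho>1, h), ?m (\<rho>2, h)}"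
    using assms(5) unfolding 1(3) 2(3) diameter_ends_def by auto
  then obtain \<rho> where \<rho>': "\<rho> \<in> {-r, r}" "cyl r \<phi>1 h = ?m (\<rho>, h)"
    using 1(1) 2(1) by blast
  have top: "diameter_at r h \<phi>1 = ?m ` ({-r..r} \<times> {h})"
  proof -
    have eq: "cyl s \<phi>1 h = ?m (s * \<rho> / r, h)" for s
    proof -
      have e: "r * cos \<phi>1 = \<rho> * cos (\<phi>2 + \<theta> * h / h)" "r * sin \<phi>1 = \<rho> * sin (\<phi>2 + \<theta> * h / h)"
        using \<rho>'(2) by (auto simp: helicoid_map_def cyl_eq_iff)
      have "s * cos \<phi>1 = s / r * (r * cos \<phi>1)" "s * sin \<phi>1 = s / r * (r * sin \<phi>1)"
        using assms(1) by simp_all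
      then show ?thesis
        unfolding e by (simp add: helicoid_map_def cyl_eq_iff)
    qed
    have "diameter_at r h \<phi>1 = (\<lambda>s. ?m (s * \<rho> / r, h)) ` {-r..r}"
      unfolding diameter_at_def eq by (auto simp: abs_le_iff)
    also have "\<dots> = (\<lambda>s. ?m (s, h)) ` (\<lambda>s. s * \<rho> / r) ` {-r..r}"
      by (simp add: image_image)
    also have "(\<lambda>s. s * \<rho> / r) ` {-r..r} = {-r..r}"
      using \<rho>'(1) assms(1) by auto
    finally show ?thesis by (auto simp: image_iff)
  qed
  have "?m ` ({-r, r} \<times> {0..h}) = path_image h1 \<union> path_image h2"
    unfolding 1(4) 2(4) \<rho>[symmetric] by blast
  then show ?thesis
    unfolding frontier_rectangle[OF assms(1,2)] bottom top by blast
qed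

section \<open>Minimal disks bounded by the boundary of a helicoid\<close>

text \<open>A crude form of Jordan's inequality, from \<open>sin w = 2 sin (w/2) cos (w/2)\<close> and \<open>sin v \<ge> v cos v\<close>.\<close>

lemma half_le_sin:
  fixes w :: real
  assumes "0 \<le> w" "w \<le> pi / 2"
  shows "w / 2 \<le> sin w"
proof (cases "w = 0")
  case False
  define v where "v = w / 2"
  have v: "v > 0" "v \<le> pi / 2" using assms False by (auto simp: v_def)
  obtain z where z: "0 < z" "z < v" "sin v - sin 0 = (v - 0) * cos z"
    using MVT2[of 0 v sin cos] v(1) by (auto intro!: derivative_eq_intros)
  have "cos v \<le> cos z"
    using z v pi_gt_zero by (intro cos_monotone_0_pi_le) auto
  then have "v * cos v \<le> sin v" using z(3) v(1) by simp
  moreover have "cos v \<ge> 0" using v by (intro cos_ge_zero) auto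
  ultimately have "2 * (v * cos v) * cos v \<le> sin w"
    using sin_double[of v] by (simp add: v_def mult_right_mono)
  moreover have "(cos v)\<^sup>2 \<ge> 1 / 2"
    using cos_double_cos[of v] cos_ge_zero[of w] assms by (simp add: v_def)
  then have "v * (2 * (cos v)\<^sup>2) \<ge> v * 1" using v(1) by (intro mult_left_mono) auto
  ultimately show ?thesis by (simp add: v_def power2_eq_square algebra_simps)
qed simp

lemma rotated_frame: "frame (vector [cos \<phi>, sin \<phi>, 0]) (vector [- sin \<phi>, cos \<phi>, 0]) (vector [0, 0, 1])"
proof
  show "v \<bullet> v = (vector [cos \<phi>, sin \<phi>, 0] \<bullet> v)\<^sup>2 + (vector [- sin \<phi>, cos \<phi>, 0] \<bullet> v)\<^sup>2
     + (vector [0, 0, 1] \<bullet> v)\<^sup>2" for v :: "real^3"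
  proof -
    have "(sin \<phi>)\<^sup>2 + (cos \<phi>)\<^sup>2 = 1" by simp
    then have "v$1 * v$1 + v$2 * v$2 + v$3 * v$3
      = (cos \<phi> * v$1 + sin \<phi> * v$2)\<^sup>2 + (cos \<phi> * v$2 - sin \<phi> * v$1)\<^sup>2 + (v$3)\<^sup>2"
      by algebra
    then show ?thesis by (simp add: inner_vec_def sum_3)
  qed
  have "cos \<phi> * cos \<phi> + sin \<phi> * sin \<phi> = 1"
    using sin_cos_squared_add[of \<phi>] by (simp add: power2_eq_square)
  then show "vector [cos \<phi>, sin \<phi>, 0] \<bullet> (vector [cos \<phi>, sin \<phi>, 0] :: real^3) = 1"
    "vector [- sin \<phi>, cos \<phi>, 0] \<bullet> (vector [- sin \<phi>, cos \<phi>, 0] :: real^3) = 1"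
    by (simp_all add: inner_vec_def sum_3 algebra_simps)
qed (simp_all add: inner_vec_def sum_3)

lemma in_helicoid_piece:
  assumes h: "h > 0" and r: "r \<ge> 0" and \<phi>: "\<phi> = \<phi>0 + \<theta> / 2" and q: "q \<in> solid_cylinder r h"
    and eq: "(vector [- sin \<phi>, cos \<phi>, 0] \<bullet> q) * cos (\<theta> / h * (q$3 - h / 2))
      = (vector [cos \<phi>, sin \<phi>, 0] \<bullet> q) * sin (\<theta> / h * (q$3 - h / 2))"
  shows "q \<in> helicoid_piece r h \<phi>0 \<theta>"
proof -
  define \<psi> x y where "\<psi> = \<theta> / h * (q$3 - h / 2)" and "x = cos \<phi> * q$1 + sin \<phi> * q$2"
    and "y = cos \<phi> * q$2 - sin \<phi> * q$1"
  define s where "s = x * cos \<psi> + y * sin \<psi>"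
  have xy: "y * cos \<psi> = x * sin \<psi>"
    using eq by (simp add: x_def y_def \<psi>_def inner_vec_def sum_3 algebra_simps)
  have c1: "(cos \<psi>)\<^sup>2 + (sin \<psi>)\<^sup>2 = 1" "(cos \<phi>)\<^sup>2 + (sin \<phi>)\<^sup>2 = 1" by simp_all
  have xs: "x = s * cos \<psi>" "y = s * sin \<psi>"
    unfolding s_def using xy c1(1) by algebra+
  have "s\<^sup>2 = x\<^sup>2 + y\<^sup>2" unfolding xs using c1(1) by algebra
  also have "\<dots> = (q$1)\<^sup>2 + (q$2)\<^sup>2" unfolding x_def y_def using c1(2) by algebra
  finally have "\<bar>s\<bar> \<le> r"
    using q r abs_le_square_iff[of s r] by (simp add: solid_cylinder_def)
  have "q$1 = s * cos (\<phi> + \<psi>)" "q$2 = s * sin (\<phi> + \<psi>)"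
  proof -
    have "q$1 = x * cos \<phi> - y * sin \<phi>" "q$2 = x * sin \<phi> + y * cos \<phi>"
      unfolding x_def y_def using c1(2) by algebra+
    then show "q$1 = s * cos (\<phi> + \<psi>)" "q$2 = s * sin (\<phi> + \<psi>)"
      unfolding xs by (simp_all add: cos_add sin_add algebra_simps)
  qed
  moreover have "\<phi> + \<psi> = \<phi>0 + \<theta> * q$3 / h"
    using h by (simp add: \<phi> \<psi>_def field_simps)
  ultimately have "q = cyl s (\<phi>0 + \<theta> * q$3 / h) (q$3)"
    by (simp add: vec_eq_iff forall_3)
  then show ?thesis
    using \<open>\<bar>s\<bar> \<le> r\<close> q unfolding helicoid_piece_def solid_cylinder_def by blast
qed

text \<open>It remains to provide the bound of \<open>x\<close> by a multiple of \<open>cos (a z)\<close>. For \<open>\<theta> < \<pi>\<close> the cosine is bounded away from \<open>0\<close>. For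
  \<open>\<theta> = \<pi>\<close> the boundary satisfies \<open>|x| \<le> r cos (a z)\<close>, so it lies in the two wedges where \<open>|x|\<close> is at most \<open>r a\<close>
  times the distance to the top, or to the bottom, of the cylinder; these are convex, hence contain the
  disk, and \<open>cos (a z)\<close> is comparable to \<open>a\<close> times the smaller of the two distances.\<close>

lemma minimal_disk_subset_helicoid:
  assumes "minimal_disk f" and r: "r > 0" and h: "h > 0" and \<theta>: "0 \<le> \<theta>" "\<theta> \<le> pi"
    and cylinder: "f ` cball 0 1 \<subseteq> solid_cylinder r h"
    and boundary: "f ` sphere 0 1 \<subseteq> helicoid_piece r h \<phi>0 \<theta>"
  shows "f ` cball 0 1 \<subseteq> helicoid_piece r h \<phi>0 \<theta>"
proof -
  define \<phi> where "\<phi> = \<phi>0 + \<theta> / 2"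
  define a where "a = \<theta> / h"
  define e1 e2 e3 :: "real^3" where "e1 = vector [cos \<phi>, sin \<phi>, 0]" and "e2 = vector [- sin \<phi>, cos \<phi>, 0]"
    and "e3 = vector [0, 0, 1]"
  interpret minimal_disk f by fact
  interpret frame e1 e2 e3 unfolding e1_def e2_def e3_def by (rule rotated_frame)
  interpret minimal_disk_in_frame f e1 e2 e3 a "h / 2" ..
  have e3: "e3 \<bullet> q = q$3" for q by (simp add: e3_def inner_vec_def sum_3)
  define ang where "ang = (\<lambda>p. a * (e3 \<bullet> f p - h / 2))"
  have z: "0 \<le> e3 \<bullet> f p" "e3 \<bullet> f p \<le> h" if "p \<in> cball 0 1" for p
  proof -
    have "f p \<in> solid_cylinder r h" using cylinder that by blast
    then show "0 \<le> e3 \<bullet> f p" "e3 \<bullet> f p \<le> h" by (simp_all add: e3 solid_cylinder_def)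
  qed
  have a0: "a \<ge> 0" "a * h = \<theta>" using \<theta> h by (auto simp: a_def)
  have ang: "\<bar>ang p\<bar> \<le> \<theta> / 2" if "p \<in> cball 0 1" for p
  proof -
    have "\<bar>e3 \<bullet> f p - h / 2\<bar> \<le> h / 2" unfolding abs_le_iff using z[OF that] by linarith
    then have "a * \<bar>e3 \<bullet> f p - h / 2\<bar> \<le> a * (h / 2)" using a0(1) by (rule mult_left_mono)
    then have "\<bar>ang p\<bar> \<le> a * (h / 2)" using a0(1) by (simp add: ang_def abs_mult)
    then show ?thesis using a0(2) by simp
  qed
  have cos0: "cos (ang p) \<ge> 0" if "p \<in> cball 0 1" for p
    using ang[OF that] \<theta> by (intro cos_ge_zero) auto
  have horizontal: "\<bar>e1 \<bullet> f p\<bar> \<le> r" "\<bar>e2 \<bullet> f p\<bar> \<le> r" if "p \<in> cball 0 1" for p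
  proof -
    have "f p \<in> solid_cylinder r h" using cylinder that by blast
    then have c: "(f p $ 1)\<^sup>2 + (f p $ 2)\<^sup>2 \<le> r\<^sup>2" by (simp add: solid_cylinder_def)
    have "(e1 \<bullet> f p)\<^sup>2 + (e2 \<bullet> f p)\<^sup>2 = (f p $ 1)\<^sup>2 + (f p $ 2)\<^sup>2"
    proof -
      have "f p \<bullet> f p = (f p $ 1)\<^sup>2 + (f p $ 2)\<^sup>2 + (f p $ 3)\<^sup>2"
        by (simp add: inner_vec_def sum_3 power2_eq_square)
      then show ?thesis using complete[of "f p"] by (simp add: e3)
    qed
    also have "\<dots> \<le> r\<^sup>2" by (rule c)
    finally have "(e1 \<bullet> f p)\<^sup>2 \<le> r\<^sup>2" "(e2 \<bullet> f p)\<^sup>2 \<le> r\<^sup>2"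
      by (smt (verit) zero_le_power2)+
    then show "\<bar>e1 \<bullet> f p\<bar> \<le> r" "\<bar>e2 \<bullet> f p\<bar> \<le> r" 
      using r abs_le_square_iff[of "e1 \<bullet> f p" r] abs_le_square_iff[of "e2 \<bullet> f p" r] by simp_all
  qed
  have bd: "(e2 \<bullet> f p) * cos (ang p) = (e1 \<bullet> f p) * sin (ang p)" "\<bar>e1 \<bullet> f p\<bar> \<le> r * cos (ang p)"
    if "p \<in> sphere 0 1" for p
  proof -
    have "f p \<in> helicoid_piece r h \<phi>0 \<theta>" using boundary that by blast
    then obtain s \<zeta> where s: "f p = cyl s (\<phi>0 + \<theta> * \<zeta> / h) \<zeta>" "\<bar>s\<bar> \<le> r"
      unfolding helicoid_piece_def by (elim CollectE exE conjE)
    have "\<phi>0 + \<theta> * \<zeta> / h = \<phi> + ang p"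
      using h by (simp add: ang_def e3 s \<phi>_def a_def field_simps)
    then have fp: "f p = cyl s (\<phi> + ang p) \<zeta>" using s(1) by simp
    have c1: "(cos \<phi>)\<^sup>2 + (sin \<phi>)\<^sup>2 = 1" by simp
    have "e1 \<bullet> f p = cos \<phi> * (s * cos (\<phi> + ang p)) + sin \<phi> * (s * sin (\<phi> + ang p))"
      "e2 \<bullet> f p = cos \<phi> * (s * sin (\<phi> + ang p)) - sin \<phi> * (s * cos (\<phi> + ang p))"
      by (simp_all add: fp e1_def e2_def inner_vec_def sum_3)
    then have "e1 \<bullet> f p = s * cos (ang p)" "e2 \<bullet> f p = s * sin (ang p)"
      using c1 unfolding cos_add sin_add by algebra+
    then show "(e2 \<bullet> f p) * cos (ang p) = (e1 \<bullet> f p) * sin (ang p)" "\<bar>e1 \<bullet> f p\<bar> \<le> r * cos (ang p)"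
      using s(2) cos0[of p] that by (auto simp: abs_mult mult_right_mono)
  qed
  obtain K where K: "K > 0" "\<And>p. p \<in> cball 0 1 \<Longrightarrow> \<bar>e1 \<bullet> f p\<bar> \<le> K * cos (ang p)"
  proof (cases "\<theta> = pi")
    case False
    then have c: "cos (\<theta> / 2) > 0" using \<theta> by (intro cos_gt_zero_pi) auto
    have "\<bar>e1 \<bullet> f p\<bar> \<le> r / cos (\<theta> / 2) * cos (ang p)" if "p \<in> cball 0 1" for p
    proof -
      have "cos (\<theta> / 2) \<le> cos \<bar>ang p\<bar>"
        using ang[OF that] \<theta> by (intro cos_monotone_0_pi_le) auto
      then have "r / cos (\<theta> / 2) * cos (\<theta> / 2) \<le> r / cos (\<theta> / 2) * cos (ang p)"
        using r c by (intro mult_left_mono) auto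
      then show ?thesis using horizontal(1)[OF that] c by simp
    qed
    then show ?thesis using that[of "r / cos (\<theta> / 2)"] r c by simp
  next
    case True
    have up: "cos (ang p) = sin (a * (h - e3 \<bullet> f p))" and down: "cos (ang p) = sin (a * (e3 \<bullet> f p))" for p
    proof -
      have "pi / 2 - ang p = a * (h - e3 \<bullet> f p)" "pi / 2 - (- ang p) = a * (e3 \<bullet> f p)"
        using a0(2) True by (simp_all add: ang_def algebra_simps)
      then show "cos (ang p) = sin (a * (h - e3 \<bullet> f p))" "cos (ang p) = sin (a * (e3 \<bullet> f p))"
        using cos_sin_eq[of "ang p"] cos_sin_eq[of "- ang p"] by simp_all
    qed
    have sb: "\<bar>e1 \<bullet> f p\<bar> \<le> r * (a * (h - e3 \<bullet> f p))" "\<bar>e1 \<bullet> f p\<bar> \<le> r * (a * (e3 \<bullet> f p))" if "p \<in> sphere 0 1" for p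
    proof -
      have p: "p \<in> cball 0 1" using that by simp
      have "cos (ang p) \<le> a * (h - e3 \<bullet> f p)"
        unfolding up using z[OF p] a0(1) by (intro sin_x_le_x) auto
      moreover have "cos (ang p) \<le> a * (e3 \<bullet> f p)"
        unfolding down using z[OF p] a0(1) by (intro sin_x_le_x) auto
      ultimately show "\<bar>e1 \<bullet> f p\<bar> \<le> r * (a * (h - e3 \<bullet> f p))" "\<bar>e1 \<bullet> f p\<bar> \<le> r * (a * (e3 \<bullet> f p))"
        using bd(2)[OF that] r by (meson mult_left_mono order_trans less_imp_le)+
    qed
    have wedge: "\<bar>e1 \<bullet> f p\<bar> \<le> r * (a * (h - e3 \<bullet> f p))" "\<bar>e1 \<bullet> f p\<bar> \<le> r * (a * (e3 \<bullet> f p))"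
      if p: "p \<in> cball 0 1" for p
    proof -
      have "(\<sigma> *\<^sub>R e1 + (r * a) *\<^sub>R e3) \<bullet> f p \<le> r * (a * h)" "(\<sigma> *\<^sub>R e1 - (r * a) *\<^sub>R e3) \<bullet> f p \<le> 0"
        if "\<bar>\<sigma>\<bar> = 1" for \<sigma>
      proof -
        have \<sigma>: "\<sigma> * w \<le> \<bar>w\<bar>" for w
          using that by (metis abs_ge_self abs_mult mult_1)
        show "(\<sigma> *\<^sub>R e1 + (r * a) *\<^sub>R e3) \<bullet> f p \<le> r * (a * h)"
        proof (rule linear_bound_from_boundary[OF _ p])
          fix p assume "p \<in> sphere (0::real^2) 1"
          from sb(1)[OF this] \<sigma>[of "e1 \<bullet> f p"] show "(\<sigma> *\<^sub>R e1 + (r * a) *\<^sub>R e3) \<bullet> f p \<le> r * (a * h)"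
            by (simp add: inner_add_left algebra_simps)
        qed
        show "(\<sigma> *\<^sub>R e1 - (r * a) *\<^sub>R e3) \<bullet> f p \<le> 0"
        proof (rule linear_bound_from_boundary[OF _ p])
          fix p assume "p \<in> sphere (0::real^2) 1"
          from sb(2)[OF this] \<sigma>[of "e1 \<bullet> f p"] show "(\<sigma> *\<^sub>R e1 - (r * a) *\<^sub>R e3) \<bullet> f p \<le> 0"
            by (simp add: inner_diff_left algebra_simps)
        qed
      qed
      from this[of 1] this[of "-1"] show "\<bar>e1 \<bullet> f p\<bar> \<le> r * (a * (h - e3 \<bullet> f p))" "\<bar>e1 \<bullet> f p\<bar> \<le> r * (a * (e3 \<bullet> f p))"
        by (auto simp: inner_add_left inner_diff_left algebra_simps abs_le_iff)
    qed
    have "\<bar>e1 \<bullet> f p\<bar> \<le> (2 * r) * cos (ang p)" if p: "p \<in> cball 0 1" for p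
    proof -
      \<comment> \<open>\<open>\<pi> / 2\<close> minus the absolute value of the angle, that is, \<open>a\<close> times the distance to the nearer end of the cylinder\<close>
      define w where "w = a * (if e3 \<bullet> f p \<le> h / 2 then e3 \<bullet> f p else h - e3 \<bullet> f p)"
      have "\<bar>e1 \<bullet> f p\<bar> \<le> r * w" and c: "cos (ang p) = sin w"
        using wedge[OF p] up[of p] down[of p] by (auto simp: w_def)
      have "w \<le> a * (h / 2)"
        using a0(1) unfolding w_def by (intro mult_left_mono) auto
      then have "w / 2 \<le> sin w"
        using a0 z[OF p] True by (intro half_le_sin) (auto simp: w_def)
      then have "r * w \<le> r * (2 * sin w)" using r by (intro mult_left_mono) auto
      with \<open>\<bar>e1 \<bullet> f p\<bar> \<le> r * w\<close> show ?thesis unfolding c by simp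
    qed
    then show ?thesis using that[of "2 * r"] r by simp
  qed
  have "f p \<in> helicoid_piece r h \<phi>0 \<theta>" if p: "p \<in> cball 0 1" for p
  proof -
    have "(e2 \<bullet> f p) * cos (ang p) = (e1 \<bullet> f p) * sin (ang p)"
    proof (cases "cos (ang p) = 0")
      case True
      then show ?thesis using K(2)[OF p] by simp
    next
      case False
      then have pos: "cos (ang p) > 0" using cos0[OF p] by simp
      have "\<sigma> * (e2 \<bullet> f p - (e1 \<bullet> f p) * tan (ang p)) \<le> 0" if "\<sigma>\<^sup>2 = 1" for \<sigma>
        using one_sided_bound[OF r K(1) that _ _ _ _ _ _ p] cos0 horizontal K(2) bd pos
        unfolding ang_def by blast
      from this[of 1] this[of "-1"] have "e2 \<bullet> f p = (e1 \<bullet> f p) * tan (ang p)" by simp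
      then show ?thesis using False by (simp add: tan_def)
    qed
    moreover have "f p \<in> solid_cylinder r h" using cylinder p by blast
    ultimately show ?thesis
      using in_helicoid_piece[OF h less_imp_le[OF r] \<phi>_def, of "f p"]
      by (simp add: ang_def a_def e3 e1_def e2_def)
  qed
  then show ?thesis by blast
qed

theorem theorem2p5:
  fixes r h \<theta> \<phi>1 \<phi>2 :: real
    and d1 d2 \<Sigma> :: "(real^3) set"
    and h1 h2 :: "real \<Rightarrow> real^3"
  assumes "r > 0" and "h > 0"
    and "d1 = diameter_at r h \<phi>1" and "d2 = diameter_at r 0 \<phi>2"
    and "double_helix r h1 h2"
    and "path_image h1 \<subseteq> side_surface r h" and "path_image h2 \<subseteq> side_surface r h"
    and "{pathstart h1, pathstart h2} = diameter_ends r 0 \<phi>2"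
    and "{pathfinish h1, pathfinish h2} = diameter_ends r h \<phi>1"
    and "rot r h1 = \<theta>" and "rot r h2 = \<theta>"
    and "0 \<le> \<theta>" and "\<theta> \<le> pi"
    and "\<Sigma> \<subseteq> solid_cylinder r h"
    and "disk_type_minimal_surface \<Sigma> (d1 \<union> d2 \<union> path_image h1 \<union> path_image h2)"
  shows "\<Sigma> = helicoid_piece r h \<phi>2 \<theta>"
proof -
  let ?R = "cbox (-r, 0) (r, h)"
  have \<Gamma>: "d1 \<union> d2 \<union> path_image h1 \<union> path_image h2 = helicoid_map h \<phi>2 \<theta> ` frontier ?R"
    unfolding assms(3,4) by (rule boundary_curve[OF assms(1,2,5,8-11)])
  obtain f where "minimal_disk f" and \<Sigma>: "f ` cball 0 1 = \<Sigma>"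
    and bd: "bij_betw f (sphere 0 1) (helicoid_map h \<phi>2 \<theta> ` frontier ?R)"
    using assms(15) unfolding \<Gamma> disk_type_minimal_surface_def minimal_disk_def by blast
  have "frontier ?R \<subseteq> ?R" by (rule frontier_subset_closed[OF closed_cbox])
  then have "f ` sphere 0 1 \<subseteq> helicoid_piece r h \<phi>2 \<theta>"
    using bd unfolding bij_betw_def helicoid_piece_eq_image by blast
  then have "f ` cball 0 1 \<subseteq> helicoid_map h \<phi>2 \<theta> ` ?R"
    using minimal_disk_subset_helicoid[OF \<open>minimal_disk f\<close> assms(1,2,12,13)] assms(14) \<Sigma>
    unfolding helicoid_piece_eq_image by blast
  moreover have "interior ?R \<noteq> {}"
  proof -
    have "(0, h / 2) \<in> interior ?R"
      using assms(1,2) by (simp add: cbox_Pair_eq interior_Times)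
    then show ?thesis by blast
  qed
  ultimately have "f ` cball 0 1 = helicoid_map h \<phi>2 \<theta> ` ?R"
    using \<open>minimal_disk f\<close> bd inj_helicoid_map[of h \<phi>2 \<theta>]
    by (intro disk_map_onto_convex_patch)
      (auto simp: minimal_disk_def continuous_on_helicoid_map intro: inj_on_subset)
  then show ?thesis
    unfolding \<Sigma> helicoid_piece_eq_image .
qed

end
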